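(* Let $(W,S)$ be a Coxeter system, let $J\subseteq S$, and let $X\subseteq T$ be an order ideal of $(T,\sqsubseteq)$. Then the map $P^J:W\to W$ is order preserving on $(W,\leqslant_{L^X})$: $u\leqslant_{L^X}v$ implies $P^J(u)\leqslant_{L^X}P^J(v)$. In particular, this holds for the $k$-intermediate orders $\leqslant_{L^k}$, for every $k\in\mathbb N$.
   Context: $(W,S)$ is a Coxeter system with length function $\ell$, reflections $T=\{wsw^{-1}:w\in W,\ s\in S\}$ and Bruhat order $\leqslant$. For $X\subseteq T$, $u\leqslant_{L^X}v$ iff $u=v$, or $\ell(u)<\ell(v)$ and there exist $t_1,\dots,t_r\in X$ with $u<t_1u<\dots<t_r\cdots t_1u=v$ in the Bruhat order. For $k\in\mathbb N$, let $T_k=\{t\in T:(\ell(t)-1)/2\leqslant k\}$ and $\leqslant_{L^k}:=\leqslant_{L^{T_k}}$. The Bruhat graph $\Omega_{W,S}$ has vertex set $W$ and an arrow $u\to v$ iff $uv^{-1}\in T$ and $u<v$; $\Omega_{W,S}(Y)$ is its induced subgraph on $Y$. A reflection subgroup $W'$ (a subgroup generated by reflections) has canonical Coxeter generators $S'=\{t\in T:N(t)\cap W'=\{t\}\}$, where $N(v)=\{t\in T:\ell(tv)<\ell(v)\}$; it is dihedral if $|S'|=2$. $t\sqsubseteq' t'$ iff $t=t'$ or there is a dihedral reflection subgroup $W'\ni t,t'$ such that the directed distance from $t$ to $t'$ in $\Omega_{W,S}(W')$ is finite; $\sqsubseteq$ is the transitive closure of $\sqsubseteq'$. For $J\subseteq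 S$, $W_J$ is the subgroup generated by $J$ and $W^J=\{w\in W:\ell(w)<\ell(ws)\ \forall s\in J\}$. Every $w$ factors uniquely as $w=w^Jw_J$ with $w^J\in W^J$, $w_J\in W_J$ and $\ell(w)=\ell(w^J)+\ell(w_J)$. Set $P^J(w):=w^J$. *)

theory Defs
  imports "HOL-Algebra.Algebra"
begin

definition wprod :: "('a, 'b) monoid_scheme \<Rightarrow> 'a list \<Rightarrow> 'a" where
  "wprod G ws = foldr (\<lambda>x y. x \<otimes>\<^bsub>G\<^esub> y) ws \<one>\<^bsub>G\<^esub>"

definition alt_word :: "'a \<Rightarrow> 'a \<Rightarrow> nat \<Rightarrow> 'a list" where
  "alt_word s t n = map (\<lambda>i. if even i then s else t) [0..<n]"

text \<open>One elementary move of the Coxeter presentation: deleting a relator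
  (s t)^m(s,t), where m(s,t) is the (finite) order of st; for s = t this is s s.\<close>
definition cox_move :: "('a, 'b) monoid_scheme \<Rightarrow> 'a set \<Rightarrow> 'a list \<Rightarrow> 'a list \<Rightarrow> bool" where
  "cox_move G S x y \<longleftrightarrow> (\<exists>u v s t. s \<in> S \<and> t \<in> S \<and> group.ord G (s \<otimes>\<^bsub>G\<^esub> t) > 0 \<and>
      x = u @ alt_word s t (2 * group.ord G (s \<otimes>\<^bsub>G\<^esub> t)) @ v \<and> y = u @ v)"

text \<open>(W,S) is a Coxeter system: S is a generating set of involutions of the group W
  and W has the presentation with generators S and relations (st)^m(s,t) = 1,
  i.e. every word in S representing the identity is a consequence of the relators.\<close>
definition coxeter_system :: "('a, 'b) monoid_scheme \<Rightarrow> 'a set \<Rightarrow> bool" where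
  "coxeter_system G S \<longleftrightarrow> group G \<and> S \<subseteq> carrier G \<and> generate G S = carrier G \<and>
     (\<forall>s\<in>S. s \<noteq> \<one>\<^bsub>G\<^esub> \<and> s \<otimes>\<^bsub>G\<^esub> s = \<one>\<^bsub>G\<^esub>) \<and>
     (\<forall>ws \<in> lists S. wprod G ws = \<one>\<^bsub>G\<^esub> \<longrightarrow> equivclp (cox_move G S) ws [])"

definition cox_len :: "('a, 'b) monoid_scheme \<Rightarrow> 'a set \<Rightarrow> 'a \<Rightarrow> nat" where
  "cox_len G S w = (LEAST n. \<exists>ws \<in> lists S. length ws = n \<and> wprod G ws = w)"

definition reflections :: "('a, 'b) monoid_scheme \<Rightarrow> 'a set \<Rightarrow> 'a set" where
  "reflections G S = {w \<otimes>\<^bsub>G\<^esub> s \<otimes>\<^bsub>G\<^esub> inv\<^bsub>G\<^esub> w | w s. w \<in> carrier G \<and> s \<in> S}"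

definition bruhat_step :: "('a, 'b) monoid_scheme \<Rightarrow> 'a set \<Rightarrow> 'a \<Rightarrow> 'a \<Rightarrow> bool" where
  "bruhat_step G S u v \<longleftrightarrow> u \<in> carrier G \<and> v \<in> carrier G \<and>
     (\<exists>t \<in> reflections G S. v = t \<otimes>\<^bsub>G\<^esub> u) \<and> cox_len G S u < cox_len G S v"

definition bruhat_le :: "('a, 'b) monoid_scheme \<Rightarrow> 'a set \<Rightarrow> 'a \<Rightarrow> 'a \<Rightarrow> bool" where
  "bruhat_le G S u v \<longleftrightarrow> u \<in> carrier G \<and> v \<in> carrier G \<and> (bruhat_step G S)\<^sup>*\<^sup>* u v"

definition bruhat_lt :: "('a, 'b) monoid_scheme \<Rightarrow> 'a set \<Rightarrow> 'a \<Rightarrow> 'a \<Rightarrow> bool" where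
  "bruhat_lt G S u v \<longleftrightarrow> bruhat_le G S u v \<and> u \<noteq> v"

definition LX_step :: "('a, 'b) monoid_scheme \<Rightarrow> 'a set \<Rightarrow> 'a set \<Rightarrow> 'a \<Rightarrow> 'a \<Rightarrow> bool" where
  "LX_step G S R x y \<longleftrightarrow> (\<exists>t \<in> R. y = t \<otimes>\<^bsub>G\<^esub> x \<and> bruhat_lt G S x y)"

definition le_LX :: "('a, 'b) monoid_scheme \<Rightarrow> 'a set \<Rightarrow> 'a set \<Rightarrow> 'a \<Rightarrow> 'a \<Rightarrow> bool" where
  "le_LX G S R u v \<longleftrightarrow> u = v \<or> (cox_len G S u < cox_len G S v \<and> (LX_step G S R)\<^sup>+\<^sup>+ u v)"

definition refl_T_k :: "('a, 'b) monoid_scheme \<Rightarrow> 'a set \<Rightarrow> nat \<Rightarrow> 'a set" where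
  "refl_T_k G S k = {t \<in> reflections G S. (real (cox_len G S t) - 1) / 2 \<le> real k}"

definition le_Lk :: "('a, 'b) monoid_scheme \<Rightarrow> 'a set \<Rightarrow> nat \<Rightarrow> 'a \<Rightarrow> 'a \<Rightarrow> bool" where
  "le_Lk G S k = le_LX G S (refl_T_k G S k)"

definition bruhat_arrow :: "('a, 'b) monoid_scheme \<Rightarrow> 'a set \<Rightarrow> 'a \<Rightarrow> 'a \<Rightarrow> bool" where
  "bruhat_arrow G S u v \<longleftrightarrow> u \<otimes>\<^bsub>G\<^esub> inv\<^bsub>G\<^esub> v \<in> reflections G S \<and> bruhat_lt G S u v"

definition bruhat_arrow_on :: "('a, 'b) monoid_scheme \<Rightarrow> 'a set \<Rightarrow> 'a set \<Rightarrow> 'a \<Rightarrow> 'a \<Rightarrow> bool" where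
  "bruhat_arrow_on G S Y u v \<longleftrightarrow> u \<in> Y \<and> v \<in> Y \<and> bruhat_arrow G S u v"

definition left_inversions :: "('a, 'b) monoid_scheme \<Rightarrow> 'a set \<Rightarrow> 'a \<Rightarrow> 'a set" where
  "left_inversions G S v = {t \<in> reflections G S. cox_len G S (t \<otimes>\<^bsub>G\<^esub> v) < cox_len G S v}"

definition reflection_subgroup :: "('a, 'b) monoid_scheme \<Rightarrow> 'a set \<Rightarrow> 'a set \<Rightarrow> bool" where
  "reflection_subgroup G S W' \<longleftrightarrow> (\<exists>R \<subseteq> reflections G S. W' = generate G R)"

definition canonical_gens :: "('a, 'b) monoid_scheme \<Rightarrow> 'a set \<Rightarrow> 'a set \<Rightarrow> 'a set" where
  "canonical_gens G S W' = {t \<in> reflections G S. left_inversions G S t \<inter> W' = {t}}"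

definition dihedral_refl_subgroup :: "('a, 'b) monoid_scheme \<Rightarrow> 'a set \<Rightarrow> 'a set \<Rightarrow> bool" where
  "dihedral_refl_subgroup G S W' \<longleftrightarrow> reflection_subgroup G S W' \<and>
     finite (canonical_gens G S W') \<and> card (canonical_gens G S W') = 2"

definition refl_sq' :: "('a, 'b) monoid_scheme \<Rightarrow> 'a set \<Rightarrow> 'a \<Rightarrow> 'a \<Rightarrow> bool" where
  "refl_sq' G S t t' \<longleftrightarrow> t \<in> reflections G S \<and> t' \<in> reflections G S \<and>
     (t = t' \<or> (\<exists>W'. dihedral_refl_subgroup G S W' \<and> t \<in> W' \<and> t' \<in> W' \<and>
                       (bruhat_arrow_on G S W')\<^sup>*\<^sup>* t t'))"

definition refl_sq :: "('a, 'b) monoid_scheme \<Rightarrow> 'a set \<Rightarrow> 'a \<Rightarrow> 'a \<Rightarrow> bool" where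
  "refl_sq G S = (refl_sq' G S)\<^sup>+\<^sup>+"

definition order_ideal_T :: "('a, 'b) monoid_scheme \<Rightarrow> 'a set \<Rightarrow> 'a set \<Rightarrow> bool" where
  "order_ideal_T G S R \<longleftrightarrow> R \<subseteq> reflections G S \<and>
     (\<forall>t t'. t' \<in> R \<longrightarrow> refl_sq G S t t' \<longrightarrow> t \<in> R)"

definition min_coset_reps :: "('a, 'b) monoid_scheme \<Rightarrow> 'a set \<Rightarrow> 'a set \<Rightarrow> 'a set" where
  "min_coset_reps G S J = {w \<in> carrier G. \<forall>s \<in> J. cox_len G S w < cox_len G S (w \<otimes>\<^bsub>G\<^esub> s)}"

definition proj_J :: "('a, 'b) monoid_scheme \<Rightarrow> 'a set \<Rightarrow> 'a set \<Rightarrow> 'a \<Rightarrow> 'a" where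
  "proj_J G S J w = (THE x. x \<in> min_coset_reps G S J \<and>
     (\<exists>y \<in> generate G J. w = x \<otimes>\<^bsub>G\<^esub> y \<and> cox_len G S w = cox_len G S x + cox_len G S y))"

end

theory Submission
  imports Defs
begin

text \<open>
  Let \<open>N(w)\<close> be the set of reflections whose walls separate \<open>1\<close> from \<open>w\<close>. The parity with which
  the gallery of a word crosses each wall is unchanged by the relators, so \<open>N\<close> is well defined and a
  cocycle: \<open>N(xy)\<close> is the symmetric difference of \<open>N(x)\<close> and \<open>x N(y) x\<inverse>\<close>. This yields the
  exchange property, and on a coset of a subgroup \<open>W'\<close> with shortest element \<open>y\<close> it shows that
  \<open>N(hy)\<close> and \<open>N(h)\<close> have the same trace on \<open>W'\<close> for \<open>h\<close> in \<open>W'\<close>.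

  The map \<open>P\<^sup>J\<close> is a composition of maps \<open>w \<mapsto> min(w, ws)\<close> with \<open>s\<close> in \<open>J\<close>, so it suffices to treat
  these, and for a single step \<open>u < tu\<close> the only nontrivial situation is \<open>x < xs < txs < tx\<close>,
  where a chain from \<open>x\<close> to \<open>txs\<close> with reflections in \<open>X\<close> is required. These elements lie in one coset
  of the dihedral group \<open>W'\<close> generated by \<open>t\<close> and \<open>xsx\<inverse>\<close>, hence the question can be settled in
  \<open>W'\<close>. There \<open>X\<close> contains all reflections that are shorter than \<open>t\<close> with respect to the
  canonical generators; these are enough to climb along the suffixes of a reduced word of \<open>txs\<close>, after
  at most one jump to the other of the two families of alternating words.
\<close>

section \<open>Words and lengths in groups generated by involutions\<close>

lemma alt_word_0 [simp]: "alt_word x y 0 = []"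
  by (simp add: alt_word_def)

lemma alt_word_Suc [simp]: "alt_word x y (Suc n) = x # alt_word y x n"
  unfolding alt_word_def by (simp add: upt_conv_Cons map_Suc_upt [symmetric] o_def del: upt_Suc)

lemma length_alt_word [simp]: "length (alt_word x y n) = n"
  by (simp add: alt_word_def)

lemma alt_word_in_lists [simp]: "x \<in> A \<Longrightarrow> y \<in> A \<Longrightarrow> alt_word x y n \<in> lists A"
  by (induction n arbitrary: x y) auto

lemma rev_in_lists [simp]: "rev ws \<in> lists A \<longleftrightarrow> ws \<in> lists A"
  by (simp add: in_lists_conv_set)

lemma alt_word_add:
  "alt_word x y (m + n) = alt_word x y m @ (if even m then alt_word x y n else alt_word y x n)"
  by (induction m arbitrary: x y) auto

lemma wprod_Nil [simp]: "wprod G [] = \<one>\<^bsub>G\<^esub>"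
  and wprod_Cons [simp]: "wprod G (x # xs) = x \<otimes>\<^bsub>G\<^esub> wprod G xs"
  by (simp_all add: wprod_def)

context group
begin

lemma inv_cancel_left [simp]:
  "x \<in> carrier G \<Longrightarrow> y \<in> carrier G \<Longrightarrow> inv x \<otimes> (x \<otimes> y) = y"
  "x \<in> carrier G \<Longrightarrow> y \<in> carrier G \<Longrightarrow> x \<otimes> (inv x \<otimes> y) = y"
  by (simp_all add: m_assoc [symmetric])

lemma wprod_closed [simp]: "ws \<in> lists (carrier G) \<Longrightarrow> wprod G ws \<in> carrier G"
  by (induction ws) auto

lemma wprod_append:
  "us \<in> lists (carrier G) \<Longrightarrow> vs \<in> lists (carrier G) \<Longrightarrow>
    wprod G (us @ vs) = wprod G us \<otimes> wprod G vs"
  by (induction us) (auto simp: m_assoc)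

text \<open>Covers \<open>S\<close>, \<open>T\<close>, subsets \<open>J\<close> of \<open>S\<close>
  and pairs of reflections alike, so that words and \<open>cox_len\<close> can be treated once, on
  \<open>generate G A\<close>.\<close>

definition involutions :: "'a set \<Rightarrow> bool" where
  "involutions A \<longleftrightarrow> A \<subseteq> carrier G \<and> (\<forall>a\<in>A. a \<otimes> a = \<one>)"

lemma involutionsD:
  assumes "involutions A" "a \<in> A"
  shows "a \<in> carrier G" "a \<otimes> a = \<one>" "inv a = a"
  using assms by (auto simp: involutions_def intro: inv_equality)

lemma involutions_lists: "involutions A \<Longrightarrow> ws \<in> lists A \<Longrightarrow> ws \<in> lists (carrier G)"
  by (auto simp: involutions_def)

lemma involutions_wprod_closed: "involutions A \<Longrightarrow> ws \<in> lists A \<Longrightarrow> wprod G ws \<in> carrier G"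
  using involutions_lists by simp

lemma involutions_wprod_append:
  "involutions A \<Longrightarrow> us \<in> lists A \<Longrightarrow> vs \<in> lists A \<Longrightarrow>
    wprod G (us @ vs) = wprod G us \<otimes> wprod G vs"
  by (rule wprod_append) (auto dest: involutions_lists)

lemma inv_wprod:
  "involutions A \<Longrightarrow> ws \<in> lists A \<Longrightarrow> inv (wprod G ws) = wprod G (rev ws)"
proof (induction ws)
  case (Cons a ws)
  then have "a \<in> A" "ws \<in> lists A" by auto
  with Cons show ?case
    using involutionsD [OF Cons.prems(1)] involutions_wprod_closed [OF Cons.prems(1)]
      involutions_wprod_append [OF Cons.prems(1), of "rev ws" "[a]"]
    by (simp add: inv_mult_group)
qed simp

lemma generate_eq_wprod:
  assumes "involutions A"
  shows "generate G A = wprod G ` lists A"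
proof (rule subset_antisym)
  show "generate G A \<subseteq> wprod G ` lists A"
  proof (rule subsetI)
    fix w assume "w \<in> generate G A"
    then show "w \<in> wprod G ` lists A"
    proof (induction rule: generate.induct)
      case one
      show ?case by (rule image_eqI [of _ _ "[]"]) auto
    next
      case (incl a)
      then show ?case using involutionsD [OF assms] by (intro image_eqI [of _ _ "[a]"]) auto
    next
      case (inv a)
      then show ?case using involutionsD [OF assms] by (intro image_eqI [of _ _ "[a]"]) auto
    next
      case (eng u v)
      then obtain us vs where "us \<in> lists A" "vs \<in> lists A" "u = wprod G us" "v = wprod G vs"
        by blast
      then show ?case
        by (intro image_eqI [of _ _ "us @ vs"]) (auto simp: involutions_wprod_append [OF assms])
    qed
  qed
next
  show "wprod G ` lists A \<subseteq> generate G A"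
  proof (rule image_subsetI)
    fix ws assume "ws \<in> lists A"
    then show "wprod G ws \<in> generate G A"
      by (induction ws) (auto intro: generate.intros)
  qed
qed

lemma cox_len_wprod_le:
  assumes "ws \<in> lists A"
  shows "cox_len G A (wprod G ws) \<le> length ws"
  unfolding cox_len_def by (rule Least_le) (use assms in blast)

lemma cox_len_word:
  assumes "involutions A" "w \<in> generate G A"
  obtains ws where "ws \<in> lists A" "length ws = cox_len G A w" "wprod G ws = w"
proof -
  have "\<exists>n. \<exists>ws\<in>lists A. length ws = n \<and> wprod G ws = w"
    using assms generate_eq_wprod by auto
  from LeastI_ex [OF this] show ?thesis
    unfolding cox_len_def [symmetric] using that by blast
qed

lemma cox_len_one [simp]: "cox_len G A \<one> = 0"
  using cox_len_wprod_le [of "[]" A] by simp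

lemma cox_len_mult_le:
  assumes "involutions A" "x \<in> generate G A" "y \<in> generate G A"
  shows "cox_len G A (x \<otimes> y) \<le> cox_len G A x + cox_len G A y"
proof -
  obtain us vs where "us \<in> lists A" "length us = cox_len G A x" "wprod G us = x"
    "vs \<in> lists A" "length vs = cox_len G A y" "wprod G vs = y"
    by (metis assms cox_len_word)
  then show ?thesis
    using cox_len_wprod_le [of "us @ vs" A] involutions_wprod_append [OF assms(1), of us vs] by auto
qed

lemma cox_len_inv_le:
  assumes "involutions A" "x \<in> generate G A"
  shows "cox_len G A (inv x) \<le> cox_len G A x"
proof -
  obtain us where "us \<in> lists A" "length us = cox_len G A x" "wprod G us = x"
    by (metis assms cox_len_word)
  then show ?thesis
    using cox_len_wprod_le [of "rev us" A] inv_wprod [OF assms(1), of us] by simp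
qed

lemma cox_len_gen_le:
  assumes "involutions A" "a \<in> A"
  shows "cox_len G A a \<le> 1"
  using cox_len_wprod_le [of "[a]" A] involutionsD [OF assms] assms by simp

end

section \<open>The inversion cocycle\<close>

text \<open>Parity of the number of times the gallery of a word crosses the wall of the reflection
  \<open>t\<close>.\<close>

primrec crossing_parity :: "('a, 'b) monoid_scheme \<Rightarrow> 'a list \<Rightarrow> 'a \<Rightarrow> bool" where
  "crossing_parity G [] t = False"
| "crossing_parity G (s # ws) t = ((t = s) \<noteq> crossing_parity G ws (s \<otimes>\<^bsub>G\<^esub> t \<otimes>\<^bsub>G\<^esub> s))"

locale coxeter = group G for G :: "('a, 'b) monoid_scheme" (structure) +
  fixes S :: "'a set"
  assumes coxeter_system: "coxeter_system G S"
begin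

abbreviation len :: "'a \<Rightarrow> nat" where "len \<equiv> cox_len G S"
abbreviation T :: "'a set" where "T \<equiv> reflections G S"

lemma S_involutions: "involutions S"
  using coxeter_system by (auto simp: coxeter_system_def involutions_def)

lemmas S_closed [simp] = involutionsD(1) [OF S_involutions]
  and S_square [simp] = involutionsD(2) [OF S_involutions]
  and S_inv [simp] = involutionsD(3) [OF S_involutions]
  and S_wprod_closed [simp] = involutions_wprod_closed [OF S_involutions]
  and S_wprod_append = involutions_wprod_append [OF S_involutions]

lemma S_generate: "generate G S = carrier G"
  using coxeter_system by (simp add: coxeter_system_def)

lemma S_cancel [simp]: "s \<in> S \<Longrightarrow> x \<in> carrier G \<Longrightarrow> s \<otimes> (s \<otimes> x) = x"
  by (simp add: m_assoc [symmetric])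

lemma wprod_eq_one_moves:
  "ws \<in> lists S \<Longrightarrow> wprod G ws = \<one> \<Longrightarrow> equivclp (cox_move G S) ws []"
  using coxeter_system by (simp add: coxeter_system_def)

lemma ex_word:
  assumes "w \<in> carrier G" obtains ws where "ws \<in> lists S" "wprod G ws = w"
  using assms generate_eq_wprod [OF S_involutions] S_generate by auto

lemma reduced_word:
  assumes "w \<in> carrier G" obtains ws where "ws \<in> lists S" "length ws = len w" "wprod G ws = w"
  using assms cox_len_word [OF S_involutions] S_generate by auto

lemma crossing_parity_append:
  assumes "us \<in> lists S" "t \<in> carrier G"
  shows "crossing_parity G (us @ vs) t \<longleftrightarrow>
    (crossing_parity G us t \<noteq> crossing_parity G vs (inv (wprod G us) \<otimes> t \<otimes> wprod G us))"
  using assms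
proof (induction us arbitrary: t)
  case (Cons s us)
  then have "s \<otimes> t \<otimes> s \<in> carrier G" by simp
  with Cons.IH [of "s \<otimes> t \<otimes> s"] Cons.hyps Cons.prems show ?case
    by (simp add: inv_mult_group m_assoc) blast
qed simp

lemma mult_pow_shift:
  assumes "s \<in> carrier G" "t \<in> carrier G"
  shows "s \<otimes> (t \<otimes> s) [^] (i::nat) = (s \<otimes> t) [^] i \<otimes> s"
proof (induction i)
  case (Suc i)
  have "s \<otimes> (t \<otimes> s) [^] Suc i = (s \<otimes> (t \<otimes> s) [^] i) \<otimes> (t \<otimes> s)"
    using assms by (simp add: m_assoc)
  then show ?case using assms by (simp add: Suc m_assoc)
qed (use assms in simp)

text \<open>Conjugation by \<open>s\<close> carries the walls met by the tail tsts... to the walls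
  met by the whole word stst..., with the exponent of st raised by one.\<close>

lemma crossing_parity_alt_word:
  assumes "s \<in> S" "t \<in> S" "r \<in> carrier G"
  shows "crossing_parity G (alt_word s t n) r \<longleftrightarrow>
    odd (\<Sum>i<n. of_bool ((s \<otimes> t) [^] i \<otimes> s = r) :: nat)"
  using assms
proof (induction n arbitrary: s t r)
  case (Suc n)
  have eq: "(t \<otimes> s) [^] i \<otimes> t = s \<otimes> r \<otimes> s \<longleftrightarrow> (s \<otimes> t) [^] Suc i \<otimes> s = r" for i :: nat
  proof -
    have "(s \<otimes> t) [^] Suc i \<otimes> s = s \<otimes> ((t \<otimes> s) [^] i \<otimes> t) \<otimes> s"
      using Suc.prems mult_pow_shift [of s t i, symmetric] by (simp add: m_assoc [symmetric])
    moreover have "x = s \<otimes> r \<otimes> s \<longleftrightarrow> s \<otimes> x \<otimes> s = r" if "x \<in> carrier G" for x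
      using Suc.prems that by (auto simp: m_assoc)
    ultimately show ?thesis using Suc.prems by simp
  qed
  have "s \<otimes> r \<otimes> s \<in> carrier G" using Suc.prems by simp
  from Suc.IH [OF Suc.prems(2,1) this] show ?case
    using Suc.prems unfolding sum.lessThan_Suc_shift eq by (auto simp del: nat_pow_Suc)
qed simp

text \<open>With m the order of st, the list of walls (st)^i s for i < 2m has period m, so every
  wall is crossed an even number of times.\<close>

lemma crossing_parity_relator:
  assumes "s \<in> S" "t \<in> S" "r \<in> carrier G"
  shows "\<not> crossing_parity G (alt_word s t (2 * ord (s \<otimes> t))) r"
proof -
  define m where "m = ord (s \<otimes> t)"
  define f where "f i = (of_bool ((s \<otimes> t) [^] i \<otimes> s = r) :: nat)" for i :: nat
  have "(s \<otimes> t) [^] (i + m) = (s \<otimes> t) [^] i" for i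
    using assms pow_ord_eq_1 [of "s \<otimes> t"] by (simp add: m_def nat_pow_mult [symmetric])
  then have per: "f (i + m) = f i" for i
    by (simp add: f_def)
  have "sum f {..<2 * m} = sum f {..<m} + sum f {m..<m + m}"
    by (simp add: mult_2 lessThan_atLeast0 sum.atLeastLessThan_concat)
  also have "sum f {m..<m + m} = sum f {..<m}"
    using sum.shift_bounds_nat_ivl [of f 0 m m] by (simp add: per lessThan_atLeast0)
  finally show ?thesis
    using crossing_parity_alt_word [OF assms, of "2 * m"] by (simp add: m_def f_def)
qed

lemma wprod_relator:
  assumes "s \<in> carrier G" "t \<in> carrier G"
  shows "wprod G (alt_word s t (2 * n)) = (s \<otimes> t) [^] n"
proof (induction n)
  case (Suc n)
  have "wprod G (alt_word s t (2 * Suc n)) = (s \<otimes> t) \<otimes> (s \<otimes> t) [^] n"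
    using assms by (simp add: Suc m_assoc)
  then show ?case using assms by (metis m_closed nat_pow_Suc2)
qed simp

lemma cox_move_invariants:
  assumes "cox_move G S x y"
  shows "x \<in> lists S \<longleftrightarrow> y \<in> lists S"
    and "even (length x) \<longleftrightarrow> even (length y)"
    and "x \<in> lists S \<Longrightarrow> r \<in> carrier G \<Longrightarrow> crossing_parity G x r \<longleftrightarrow> crossing_parity G y r"
proof -
  obtain u v s t where *: "s \<in> S" "t \<in> S"
      "x = u @ alt_word s t (2 * ord (s \<otimes> t)) @ v" "y = u @ v"
    using assms unfolding cox_move_def by blast
  then show "x \<in> lists S \<longleftrightarrow> y \<in> lists S"
    using alt_word_in_lists [of s S t "2 * ord (s \<otimes> t)"] by (auto simp: in_lists_conv_set)
  show "even (length x) \<longleftrightarrow> even (length y)" using * by simp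
  assume "x \<in> lists S" "r \<in> carrier G"
  then have u: "u \<in> lists S" using * by simp
  have *: "crossing_parity G (alt_word s t (2 * ord (s \<otimes> t)) @ v) r' \<longleftrightarrow> crossing_parity G v r'"
    if "r' \<in> carrier G" for r'
    using that * crossing_parity_append [of "alt_word s t (2 * ord (s \<otimes> t))" r' v]
      crossing_parity_relator [of s t r'] wprod_relator [of s t "ord (s \<otimes> t)"]
    by (simp add: pow_ord_eq_1)
  show "crossing_parity G x r \<longleftrightarrow> crossing_parity G y r"
    using \<open>r \<in> carrier G\<close> u by (simp add: \<open>x = _\<close> \<open>y = _\<close> crossing_parity_append *)
qed

lemma trivial_word:
  assumes "ws \<in> lists S" "wprod G ws = \<one>"
  shows "even (length ws)" "r \<in> carrier G \<Longrightarrow> \<not> crossing_parity G ws r"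
proof -
  have "equivclp (cox_move G S) ws []" using assms by (rule wprod_eq_one_moves)
  \<comment> \<open>Membership in \<open>lists S\<close> travels through the induction because
    crossing parity is invariant only for words over \<open>S\<close>, while \<open>cox_move\<close>
    leaves the surrounding words arbitrary.\<close>
  then have "(ws \<in> lists S \<longleftrightarrow> [] \<in> lists S) \<and> (even (length ws) \<longleftrightarrow> even (length ([]::'a list))) \<and>
     (\<forall>r\<in>carrier G. crossing_parity G ws r \<longleftrightarrow> crossing_parity G [] r)"
    unfolding equivclp_def
  proof (induction rule: converse_rtranclp_induct)
    case (step x y)
    from step.hyps(1) consider "cox_move G S x y" | "cox_move G S y x"
      by (auto simp: symclp_def)
    then show ?case
      by cases (use step.IH cox_move_invariants in \<open>(metis lists.Nil)+\<close>)
  qed simp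
  then show "even (length ws)" "r \<in> carrier G \<Longrightarrow> \<not> crossing_parity G ws r" by auto
qed

text \<open>Both \<open>us @ rev vs\<close> and \<open>vs @ rev vs\<close> represent the identity.
  As \<open>us\<close> and \<open>vs\<close> have the same product, \<open>rev vs\<close>
  contributes equally to both parities and cancels.\<close>

lemma crossing_parity_cong:
  assumes "us \<in> lists S" "vs \<in> lists S" "wprod G us = wprod G vs" "r \<in> carrier G"
  shows "crossing_parity G us r \<longleftrightarrow> crossing_parity G vs r"
proof -
  have "\<not> crossing_parity G (ws @ rev vs) r" if "ws \<in> lists S" "wprod G ws = wprod G vs" for ws
  proof (rule trivial_word(2))
    show "ws @ rev vs \<in> lists S" using that assms by auto
    show "wprod G (ws @ rev vs) = \<one>"
      using that assms inv_wprod [OF S_involutions, of vs, symmetric]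
        S_wprod_append [of ws "rev vs"] by simp
  qed fact
  from this [of us] this [of vs] show ?thesis
    using assms by (auto simp: crossing_parity_append)
qed

lemma even_length_cong:
  assumes "us \<in> lists S" "vs \<in> lists S" "wprod G us = wprod G vs"
  shows "even (length us) \<longleftrightarrow> even (length vs)"
proof -
  have "wprod G (us @ rev vs) = \<one>"
    using assms inv_wprod [OF S_involutions, of vs, symmetric]
      S_wprod_append [of us "rev vs"] by simp
  moreover have "us @ rev vs \<in> lists S" using assms by auto
  ultimately show ?thesis using trivial_word(1) [of "us @ rev vs"] by simp
qed

section \<open>Parity of the length, and reflections\<close>

lemma even_len_wprod: "ws \<in> lists S \<Longrightarrow> even (len (wprod G ws)) \<longleftrightarrow> even (length ws)"
  by (metis S_wprod_closed even_length_cong reduced_word)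

lemma even_len_mult:
  assumes "x \<in> carrier G" "y \<in> carrier G"
  shows "even (len (x \<otimes> y)) \<longleftrightarrow> (even (len x) \<longleftrightarrow> even (len y))"
proof -
  obtain us vs where "us \<in> lists S" "wprod G us = x" "vs \<in> lists S" "wprod G vs = y"
    by (metis assms ex_word)
  then show ?thesis
    using even_len_wprod [of "us @ vs"] even_len_wprod [of us] even_len_wprod [of vs]
    by (auto simp: S_wprod_append)
qed

lemma odd_len_S: "s \<in> S \<Longrightarrow> odd (len s)"
  using even_len_wprod [of "[s]"] by simp

lemma even_len_inv: "x \<in> carrier G \<Longrightarrow> even (len (inv x)) \<longleftrightarrow> even (len x)"
  using even_len_mult [of "inv x" x] by simp

lemma len_inv: "x \<in> carrier G \<Longrightarrow> len (inv x) = len x"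
  using cox_len_inv_le [OF S_involutions, of x] cox_len_inv_le [OF S_involutions, of "inv x"]
  by (simp add: S_generate)

lemma reflectionE:
  assumes "t \<in> T" obtains p s where "p \<in> carrier G" "s \<in> S" "t = p \<otimes> s \<otimes> inv p"
  using assms unfolding reflections_def by blast

lemma S_subset_T: "s \<in> S \<Longrightarrow> s \<in> T"
  unfolding reflections_def by (intro CollectI exI [of _ \<one>] exI [of _ s]) simp

lemma T_involutions: "involutions T"
  unfolding involutions_def
proof (intro conjI subsetI ballI)
  fix t assume "t \<in> T"
  then obtain p s where "p \<in> carrier G" "s \<in> S" "t = p \<otimes> s \<otimes> inv p" by (rule reflectionE)
  then show "t \<in> carrier G" "t \<otimes> t = \<one>" by (simp_all add: m_assoc)
qed

lemmas T_closed [simp] = involutionsD(1) [OF T_involutions]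
  and T_square [simp] = involutionsD(2) [OF T_involutions]
  and T_inv [simp] = involutionsD(3) [OF T_involutions]

lemma T_cancel [simp]: "t \<in> T \<Longrightarrow> x \<in> carrier G \<Longrightarrow> t \<otimes> (t \<otimes> x) = x"
  by (simp add: m_assoc [symmetric])

lemma T_conj:
  assumes "t \<in> T" "x \<in> carrier G" shows "x \<otimes> t \<otimes> inv x \<in> T"
proof -
  obtain p s where "p \<in> carrier G" "s \<in> S" "t = p \<otimes> s \<otimes> inv p" using assms(1) by (rule reflectionE)
  then show ?thesis using assms(2) unfolding reflections_def
    by (intro CollectI exI [of _ "x \<otimes> p"] exI [of _ s]) (simp add: inv_mult_group m_assoc)
qed

lemma T_conj': "t \<in> T \<Longrightarrow> x \<in> carrier G \<Longrightarrow> inv x \<otimes> t \<otimes> x \<in> T"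
  using T_conj [of t "inv x"] by simp

lemma odd_len_T: "t \<in> T \<Longrightarrow> odd (len t)"
  by (elim reflectionE) (auto simp: even_len_mult even_len_inv odd_len_S)

text \<open>Equal to \<open>left_inversions G S w\<close>, but only by the exchange property, which needs the cocycle
  identity first.\<close>

definition inversions :: "'a \<Rightarrow> 'a set" where
  "inversions w = {t \<in> T. crossing_parity G (SOME ws. ws \<in> lists S \<and> wprod G ws = w) t}"

lemma inversions_wprod:
  assumes "ws \<in> lists S" "t \<in> T"
  shows "t \<in> inversions (wprod G ws) \<longleftrightarrow> crossing_parity G ws t"
proof -
  define us where "us = (SOME us. us \<in> lists S \<and> wprod G us = wprod G ws)"
  have "us \<in> lists S \<and> wprod G us = wprod G ws"
    unfolding us_def by (rule someI [of _ ws]) (use assms in auto)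
  then show ?thesis
    using crossing_parity_cong [of us ws t] assms by (simp add: inversions_def us_def [symmetric])
qed

lemma inversions_subset: "inversions w \<subseteq> T"
  by (auto simp: inversions_def)

text \<open>Concatenating words for \<open>x\<close> and \<open>y\<close> turns
  \<open>crossing_parity_append\<close> into the cocycle identity on group elements.\<close>

lemma inversions_mult:
  assumes "x \<in> carrier G" "y \<in> carrier G" "t \<in> T"
  shows "t \<in> inversions (x \<otimes> y) \<longleftrightarrow> (t \<in> inversions x) \<noteq> (inv x \<otimes> t \<otimes> x \<in> inversions y)"
proof -
  obtain us vs where *: "us \<in> lists S" "wprod G us = x" "vs \<in> lists S" "wprod G vs = y"
    by (metis assms(1,2) ex_word)
  then show ?thesis
    using inversions_wprod [of "us @ vs" t] inversions_wprod [of us t]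
      inversions_wprod [of vs "inv x \<otimes> t \<otimes> x"] crossing_parity_append [of us t vs] assms
    by (simp add: S_wprod_append T_conj')
qed

lemma inversions_one [simp]: "inversions \<one> = {}"
  using inversions_wprod [of "[]"] inversions_subset by auto

lemma inversions_S: "s \<in> S \<Longrightarrow> inversions s = {s}"
  using inversions_wprod [of "[s]"] inversions_subset [of s] S_subset_T by auto

lemma inversions_inv:
  assumes "x \<in> carrier G" "t \<in> T"
  shows "t \<in> inversions (inv x) \<longleftrightarrow> x \<otimes> t \<otimes> inv x \<in> inversions x"
  using inversions_mult [of "inv x" x t] assms by simp

text \<open>In the word for p s p^-1 the contributions of p and of p^-1 to the wall of
  \<open>t\<close> cancel, and the single crossing at the middle letter s remains.\<close>

lemma T_in_inversions:
  assumes "t \<in> T" shows "t \<in> inversions t"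
proof -
  obtain p s where *: "p \<in> carrier G" "s \<in> S" "t = p \<otimes> s \<otimes> inv p" using assms by (rule reflectionE)
  have sT: "s \<in> T" using * S_subset_T by blast
  have "t \<in> inversions (p \<otimes> (s \<otimes> inv p)) \<longleftrightarrow>
      (t \<in> inversions p) \<noteq> (s \<in> inversions (s \<otimes> inv p))"
    using inversions_mult [of p "s \<otimes> inv p" t] * assms by (simp add: m_assoc)
  also have "s \<in> inversions (s \<otimes> inv p) \<longleftrightarrow> s \<notin> inversions (inv p)"
    using inversions_mult [of s "inv p" s] * sT by (simp add: inversions_S)
  also have "s \<in> inversions (inv p) \<longleftrightarrow> t \<in> inversions p"
    using inversions_inv [of p s] * sT by simp
  finally show ?thesis using * by (simp add: m_assoc)
qed

lemma inversions_mult_self: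
  "t \<in> T \<Longrightarrow> x \<in> carrier G \<Longrightarrow> t \<in> inversions (t \<otimes> x) \<longleftrightarrow> t \<notin> inversions x"
  using inversions_mult [of t x t] by (simp add: T_in_inversions m_assoc)

text \<open>The second condition on \<open>A\<close> holds for \<open>S\<close>, for
  \<open>J\<close> and for the canonical generators of a dihedral subgroup. While the first letter a
  differs from \<open>c\<close>, the inversion is passed on as aca to the rest of the word; the
  letter at which the two coincide is deleted.\<close>

lemma deletion:
  assumes A: "A \<subseteq> T" "\<And>a. a \<in> A \<Longrightarrow> inversions a \<inter> generate G A = {a}"
    and "ws \<in> lists A" "c \<in> T" "c \<in> generate G A" "c \<in> inversions (wprod G ws)"
  shows "\<exists>us \<in> lists A. length us < length ws \<and> wprod G us = c \<otimes> wprod G ws"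
  using assms(3-)
proof (induction ws arbitrary: c)
  case (Cons a ws)
  from Cons.hyps have *: "a \<in> A" "ws \<in> lists A" "a \<in> T" using A(1) by auto
  then have w: "wprod G ws \<in> carrier G"
    using A(1) T_involutions by (metis involutions_wprod_closed lists_mono subsetD)
  show ?case
  proof (cases "c = a")
    case True
    then show ?thesis using * w by (intro bexI [of _ ws]) auto
  next
    case False
    then have "c \<notin> inversions a" using A(2) [of a] * Cons.prems by auto
    then have "a \<otimes> c \<otimes> a \<in> inversions (wprod G ws)"
      using inversions_mult [of a "wprod G ws" c] Cons.prems * w by simp
    moreover have "a \<otimes> c \<otimes> a \<in> generate G A"
      using * Cons.prems by (auto intro: generate.intros)
    moreover have "a \<otimes> c \<otimes> a \<in> T" using T_conj [of c a] Cons.prems * by simp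
    ultimately obtain us where us: "us \<in> lists A" "length us < length ws"
        "wprod G us = a \<otimes> c \<otimes> a \<otimes> wprod G ws"
      using Cons.IH * by blast
    then show ?thesis using * w Cons.prems by (intro bexI [of _ "a # us"]) (auto simp: m_assoc)
  qed
qed simp

lemma involutions_subset_T: "A \<subseteq> T \<Longrightarrow> involutions A"
  using T_involutions by (auto simp: involutions_def)

lemma exchange:
  assumes A: "A \<subseteq> T" "\<And>a. a \<in> A \<Longrightarrow> inversions a \<inter> generate G A = {a}"
    and "w \<in> generate G A" "c \<in> T" "c \<in> generate G A"
  shows "c \<in> inversions w \<longleftrightarrow> cox_len G A (c \<otimes> w) < cox_len G A w"
proof -
  have inv: "involutions A" using A(1) by (rule involutions_subset_T)
  \<comment> \<open>Proved for every \<open>w\<close>, since the converse applies it to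
    \<open>c \<otimes> w\<close>: exactly one of \<open>w\<close> and \<open>c \<otimes> w\<close>
    has \<open>c\<close> as an inversion.\<close>
  have *: "cox_len G A (c \<otimes> w) < cox_len G A w" if "w \<in> generate G A" "c \<in> inversions w" for w
  proof -
    obtain ws where ws: "ws \<in> lists A" "length ws = cox_len G A w" "wprod G ws = w"
      using cox_len_word [OF inv \<open>w \<in> _\<close>] .
    then have "c \<in> inversions (wprod G ws)" using that by simp
    from deletion [OF A ws(1) assms(4,5) this] obtain us
      where "us \<in> lists A" "length us < length ws" "wprod G us = c \<otimes> wprod G ws" by blast
    then show ?thesis using ws cox_len_wprod_le [of us A] by simp
  qed
  have w: "w \<in> carrier G"
    using assms(3) generate_eq_wprod [OF inv] involutions_wprod_closed [OF inv] by auto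
  show ?thesis
  proof
    assume "cox_len G A (c \<otimes> w) < cox_len G A w"
    moreover have "c \<otimes> w \<in> generate G A" using assms generate.eng by metis
    ultimately show "c \<in> inversions w"
      using * [of "c \<otimes> w"] inversions_mult_self [of c w] assms w by fastforce
  qed (use * assms in simp)
qed

lemma inversions_iff:
  "w \<in> carrier G \<Longrightarrow> t \<in> T \<Longrightarrow> t \<in> inversions w \<longleftrightarrow> len (t \<otimes> w) < len w"
  using exchange [of S w t] inversions_S S_subset_T by (auto simp: S_generate)

lemma left_inversions_eq: "w \<in> carrier G \<Longrightarrow> left_inversions G S w = inversions w"
  using inversions_iff inversions_subset unfolding left_inversions_def by blast

lemma not_inversions_iff:
  "w \<in> carrier G \<Longrightarrow> t \<in> T \<Longrightarrow> t \<notin> inversions w \<longleftrightarrow> len w < len (t \<otimes> w)"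
  using inversions_iff [of "t \<otimes> w" t] inversions_mult_self [of t w] by simp

end

section \<open>Canonical generators of reflection subgroups\<close>

context coxeter
begin

lemma canonical_gens_iff: "t \<in> canonical_gens G S H \<longleftrightarrow> t \<in> T \<and> inversions t \<inter> H = {t}"
  using left_inversions_eq by (auto simp: canonical_gens_def)

lemma canonical_gens_subset: "canonical_gens G S H \<subseteq> T \<inter> H"
  by (auto simp: canonical_gens_iff)

lemma canonical_gens_carrier: "canonical_gens G S H \<subseteq> carrier G"
  by (auto simp: canonical_gens_iff)

text \<open>In the cocycle identity \<open>y\<close> enters only through the conjugate of
  \<open>c\<close> by the inverse of \<open>h\<close>, which lies in \<open>H\<close>, where
  \<open>y\<close> has no inversions.\<close>

lemma inversions_coset:
  assumes "subgroup H G" "y \<in> carrier G" "inversions y \<inter> H = {}" "h \<in> H" "c \<in> T" "c \<in> H"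
  shows "c \<in> inversions (h \<otimes> y) \<longleftrightarrow> c \<in> inversions h"
proof -
  have "h \<in> carrier G" using assms(1,4) subgroup.mem_carrier by metis
  moreover have "inv h \<otimes> c \<otimes> h \<in> H"
    using assms(1,4,6) by (simp add: subgroup.m_closed subgroup.m_inv_closed)
  ultimately show ?thesis using inversions_mult [of h y c] assms by blast
qed

text \<open>This is the wall through which a gallery leaves the fundamental region of
  \<open>H\<close>. Writing p for the reflection, py = ys; so N(p) and N(ys) have the same trace on
  \<open>H\<close>, and ys adds only p to the inversions of \<open>y\<close>.\<close>

lemma crossing_canonical:
  assumes "subgroup H G" "y \<in> carrier G" "inversions y \<inter> H = {}" "s \<in> S"
    and p: "y \<otimes> s \<otimes> inv y \<in> H"
  shows "y \<otimes> s \<otimes> inv y \<in> canonical_gens G S H"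
proof -
  let ?p = "y \<otimes> s \<otimes> inv y"
  have pT: "?p \<in> T" using assms T_conj S_subset_T by blast
  have "c \<in> inversions ?p \<longleftrightarrow> c = ?p" if "c \<in> T" "c \<in> H" for c
  proof -
    have "c \<in> inversions ?p \<longleftrightarrow> c \<in> inversions (?p \<otimes> y)"
      using inversions_coset [OF assms(1-3) p that] by simp
    also have "?p \<otimes> y = y \<otimes> s" using assms by (simp add: m_assoc)
    also have "c \<in> inversions (y \<otimes> s) \<longleftrightarrow> inv y \<otimes> c \<otimes> y = s"
      using inversions_mult [of y s c] assms that inversions_S [of s] by auto
    also have "\<dots> \<longleftrightarrow> c = ?p"
      using assms that by (auto simp: m_assoc)
    finally show ?thesis .
  qed
  then show ?thesis
    using pT p inversions_subset [of ?p] by (auto simp: canonical_gens_iff)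
qed

text \<open>Follow a reduced word of \<open>w\<close>: the first wall of \<open>H\<close> that its
  gallery crosses is canonical by \<open>crossing_canonical\<close>.\<close>

lemma first_crossing:
  assumes "subgroup H G" "w \<in> carrier G" "inversions w \<inter> H \<noteq> {}"
  shows "inversions w \<inter> canonical_gens G S H \<noteq> {}"
  using assms(2,3)
proof (induction "len w" arbitrary: w rule: less_induct)
  case less
  obtain ws where ws: "ws \<in> lists S" "length ws = len w" "wprod G ws = w"
    using less.prems reduced_word by metis
  moreover have "ws \<noteq> []" using less.prems ws by auto
  ultimately obtain us s where us: "ws = us @ [s]" "us \<in> lists S" "s \<in> S"
    by (cases ws rule: rev_cases) auto
  define v where "v = wprod G us"
  have v: "v \<in> carrier G" using us by (simp add: v_def)
  have w: "w = v \<otimes> s" using us ws S_wprod_append [of us "[s]"] by (simp add: v_def)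
  have lv: "len v < len w" using ws us cox_len_wprod_le [of us S] by (simp add: v_def)
  define p where "p = v \<otimes> s \<otimes> inv v"
  have p: "p \<in> T" "p \<otimes> v = w"
    using us v w T_conj S_subset_T by (auto simp: p_def m_assoc)
  \<comment> \<open>The last letter of a reduced word adds exactly one inversion.\<close>
  have inv_w: "c \<in> inversions w \<longleftrightarrow> c \<in> inversions v \<or> c = p" if "c \<in> T" for c
  proof -
    have "p \<notin> inversions v" using p lv v by (simp add: not_inversions_iff)
    moreover have "inv v \<otimes> c \<otimes> v = s \<longleftrightarrow> c = p"
      using us v that by (auto simp: p_def m_assoc)
    ultimately show ?thesis
      using inversions_mult [of v s c] that us v w inversions_S [of s] by auto
  qed
  show ?case
  proof (cases "inversions v \<inter> H = {}")
    case True
    obtain c where "c \<in> T" "c \<in> inversions w" "c \<in> H"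
      using less.prems inversions_subset by blast
    then have "p \<in> H" using inv_w True by blast
    then show ?thesis
      using crossing_canonical [OF assms(1) v True us(3)] inv_w p by (auto simp: p_def)
  next
    case False
    then obtain c where "c \<in> inversions v" "c \<in> canonical_gens G S H"
      using less.hyps [OF lv v] by blast
    then show ?thesis using inv_w canonical_gens_subset by blast
  qed
qed

text \<open>As long as \<open>H\<close> contains an inversion of \<open>x\<close>, it contains a
  canonical one, and multiplying by it shortens \<open>x\<close>. That \<open>h\<close> is built
  from canonical generators is what later shows that these generate.\<close>

lemma min_coset_rep:
  assumes "subgroup H G" "x \<in> carrier G"
  shows "\<exists>h \<in> generate G (canonical_gens G S H). \<exists>y \<in> carrier G.
    x = h \<otimes> y \<and> inversions y \<inter> H = {}"
  using assms(2)
proof (induction "len x" arbitrary: x rule: less_induct)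
  case less
  let ?C = "canonical_gens G S H"
  have C: "generate G ?C \<subseteq> carrier G"
    using canonical_gens_carrier by (rule generate_incl)
  show ?case
  proof (cases "inversions x \<inter> H = {}")
    case True
    then show ?thesis using less.prems
      by (intro bexI [of _ \<one>] bexI [of _ x]) (auto intro: generate.one)
  next
    case False
    then obtain c where c: "c \<in> inversions x" "c \<in> ?C"
      using first_crossing [OF assms(1)] less.prems by blast
    then have cT: "c \<in> T" using inversions_subset by auto
    then have "len (c \<otimes> x) < len x" "c \<otimes> x \<in> carrier G"
      using inversions_iff c less.prems by auto
    from less.hyps [OF this] obtain h y where hy: "h \<in> generate G ?C" "y \<in> carrier G"
      "c \<otimes> x = h \<otimes> y" "inversions y \<inter> H = {}" by blast
    have "x = c \<otimes> (c \<otimes> x)" using cT less.prems by simp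
    also have "\<dots> = c \<otimes> h \<otimes> y" using cT hy C by (auto simp: m_assoc)
    finally have "x = c \<otimes> h \<otimes> y" .
    moreover have "c \<otimes> h \<in> generate G ?C" using c hy by (auto intro: generate.intros)
    ultimately show ?thesis using hy by blast
  qed
qed

text \<open>Write t = p s p^-1 and split p = hy with y minimal in its coset. Then y s y^-1 lies in
  \<open>H\<close>, and \<open>crossing_canonical\<close> makes it a canonical generator.\<close>

lemma reflection_conj_canonical:
  assumes "subgroup H G" "t \<in> T" "t \<in> H"
  obtains h a where "h \<in> generate G (canonical_gens G S H)" "a \<in> canonical_gens G S H"
    "t = h \<otimes> a \<otimes> inv h"
proof -
  let ?C = "canonical_gens G S H"
  have C: "generate G ?C \<subseteq> H"
    using canonical_gens_subset [of H] assms(1) by (intro generate_subgroup_incl) auto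
  obtain p s where p: "p \<in> carrier G" "s \<in> S" "t = p \<otimes> s \<otimes> inv p" using assms(2) by (rule reflectionE)
  obtain h y where hy: "h \<in> generate G ?C" "y \<in> carrier G" "p = h \<otimes> y" "inversions y \<inter> H = {}"
    using min_coset_rep [OF assms(1) p(1)] by blast
  have h: "h \<in> H" "h \<in> carrier G" using hy C assms(1) subgroup.subset by blast+
  have eq: "t = h \<otimes> (y \<otimes> s \<otimes> inv y) \<otimes> inv h"
    using p hy h by (simp add: inv_mult_group m_assoc)
  then have "y \<otimes> s \<otimes> inv y = inv h \<otimes> t \<otimes> h"
    using hy h p by (simp add: m_assoc)
  then have "y \<otimes> s \<otimes> inv y \<in> H"
    using h assms by (simp add: subgroup.m_closed subgroup.m_inv_closed)
  then show ?thesis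
    using that [OF hy(1) crossing_canonical [OF assms(1) hy(2,4) p(2)] eq] by blast
qed

lemma reflection_in_generate_canonical:
  assumes "subgroup H G" "t \<in> T" "t \<in> H"
  shows "t \<in> generate G (canonical_gens G S H)"
proof -
  obtain h a where *: "h \<in> generate G (canonical_gens G S H)" "a \<in> canonical_gens G S H"
    "t = h \<otimes> a \<otimes> inv h"
    using assms by (rule reflection_conj_canonical)
  moreover have "subgroup (generate G (canonical_gens G S H)) G"
    using canonical_gens_carrier by (rule generate_is_subgroup)
  ultimately show ?thesis
    by (simp add: generate.incl subgroup.m_closed subgroup.m_inv_closed)
qed

lemma generate_canonical_gens:
  assumes "R \<subseteq> T"
  shows "generate G (canonical_gens G S (generate G R)) = generate G R"
proof (rule subset_antisym)
  have "subgroup (generate G R) G" using assms by (intro generate_is_subgroup) auto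
  then show "generate G (canonical_gens G S (generate G R)) \<subseteq> generate G R"
    using canonical_gens_subset [of "generate G R"] by (intro generate_subgroup_incl) auto
  have "R \<subseteq> generate G (canonical_gens G S (generate G R))"
    using reflection_in_generate_canonical [OF \<open>subgroup _ G\<close>] assms
    by (auto intro: generate.incl)
  moreover have "subgroup (generate G (canonical_gens G S (generate G R))) G"
    using canonical_gens_carrier by (rule generate_is_subgroup)
  ultimately show "generate G R \<subseteq> generate G (canonical_gens G S (generate G R))"
    by (rule generate_subgroup_incl)
qed

section \<open>Subgroups generated by two reflections\<close>

lemma two_gens_alternating:
  assumes "a \<in> T" "b \<in> T" "ws \<in> lists {a, b}"
  shows "\<exists>x y n. (x = a \<and> y = b \<or> x = b \<and> y = a) \<and> n \<le> length ws \<and> wprod G ws = wprod G (alt_word x y n)"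
  using assms(3)
proof (induction ws rule: lists.induct)
  case Nil
  show ?case by (intro exI [of _ a] exI [of _ b] exI [of _ 0]) simp
next
  case (Cons c ws)
  then obtain x y n where *: "x = a \<and> y = b \<or> x = b \<and> y = a" "n \<le> length ws"
    "wprod G ws = wprod G (alt_word x y n)" by blast
  have xy: "x \<in> T" "y \<in> T" "c = x \<or> c = y" using * Cons.hyps assms by auto
  show ?case
  proof (cases "c = x \<and> n > 0")
    case True
    then obtain m where "n = Suc m" using gr0_implies_Suc by blast
    moreover have "wprod G (alt_word y x m) \<in> carrier G"
      using xy by (intro wprod_closed) simp
    ultimately show ?thesis using * True xy
      by (intro exI [of _ y] exI [of _ x] exI [of _ m]) auto
  next
    case False
    show ?thesis
    proof (cases "n = 0")
      case True
      obtain d where "c = a \<and> d = b \<or> c = b \<and> d = a" using xy(3) *(1) by blast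
      then show ?thesis using *(3) True by (intro exI [of _ c] exI [of _ d] exI [of _ 1]) auto
    next
      case False
      then have "c = y" using \<open>\<not> (c = x \<and> n > 0)\<close> xy(3) by simp
      then show ?thesis using * by (intro exI [of _ y] exI [of _ x] exI [of _ "Suc n"]) auto
    qed
  qed
qed

lemma two_gens_reduced:
  assumes "a \<in> T" "b \<in> T" "w \<in> generate G {a, b}"
  obtains x y where "x = a \<and> y = b \<or> x = b \<and> y = a" "w = wprod G (alt_word x y (cox_len G {a, b} w))"
proof -
  have inv: "involutions {a, b}" using assms by (intro involutions_subset_T) auto
  obtain ws where ws: "ws \<in> lists {a, b}" "length ws = cox_len G {a, b} w" "wprod G ws = w"
    using cox_len_word [OF inv assms(3)] .
  obtain x y n where *: "x = a \<and> y = b \<or> x = b \<and> y = a" "n \<le> length ws" "w = wprod G (alt_word x y n)"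
    using two_gens_alternating [OF assms(1,2) ws(1), unfolded ws(3)] by blast
  moreover have "alt_word x y n \<in> lists {a, b}" using * by (intro alt_word_in_lists) auto
  then have "cox_len G {a, b} w \<le> n"
    using cox_len_wprod_le [of "alt_word x y n" "{a, b}"] * by simp
  ultimately have "n = cox_len G {a, b} w" using ws by simp
  then show ?thesis using that * by blast
qed

lemma T_alt_word_closed [simp]: "x \<in> T \<Longrightarrow> y \<in> T \<Longrightarrow> wprod G (alt_word x y n) \<in> carrier G"
  by (intro wprod_closed) simp

lemma even_len_alt_word:
  "x \<in> T \<Longrightarrow> y \<in> T \<Longrightarrow> even (len (wprod G (alt_word x y n))) \<longleftrightarrow> even n"
  by (induction n arbitrary: x y) (auto simp: even_len_mult odd_len_T)

text \<open>An alternating word of odd length is a palindrome, hence a conjugate of its middle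
  letter; the induction strips the two outer letters.\<close>

lemma odd_alt_word_reflection:
  assumes "x \<in> T" "y \<in> T"
  shows "wprod G (alt_word x y (2 * n + 1)) \<in> T"
  using assms
proof (induction n arbitrary: x y)
  case (Suc n)
  let ?w = "alt_word y x (2 * n + 1)"
  have "alt_word x y (2 * Suc n + 1) = x # alt_word y x ((2 * n + 1) + 1)" by simp
  also have "\<dots> = x # ?w @ [x]" unfolding alt_word_add by simp
  finally have eq: "alt_word x y (2 * Suc n + 1) = x # ?w @ [x]" .
  have "wprod G (?w @ [x]) = wprod G ?w \<otimes> x"
    using Suc.prems wprod_append [of ?w "[x]"] alt_word_in_lists [of y "carrier G" x "2 * n + 1"] by simp
  moreover have "x \<otimes> wprod G ?w \<otimes> x \<in> T"
    using T_conj [OF Suc.IH [OF Suc.prems(2,1)], of x] Suc.prems by simp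
  ultimately show ?case
    using Suc.prems T_alt_word_closed [of y x "2 * n + 1"] unfolding eq by (simp add: m_assoc)
qed simp

text \<open>Nothing is assumed about canonical generators here, because the proof that there are
  exactly two of them relies on this fact.\<close>

lemma two_gens_odd_reflection:
  assumes "a \<in> T" "b \<in> T" "w \<in> generate G {a, b}" "odd (len w)"
  shows "w \<in> T"
proof -
  obtain x y where xy: "x = a \<and> y = b \<or> x = b \<and> y = a" "w = wprod G (alt_word x y (cox_len G {a, b} w))"
    using assms(1-3) by (rule two_gens_reduced)
  then have "x \<in> T" "y \<in> T" using assms by auto
  then have "odd (cox_len G {a, b} w)" using xy assms even_len_alt_word by metis
  then show ?thesis
    using odd_alt_word_reflection [OF \<open>x \<in> T\<close> \<open>y \<in> T\<close>] xy by (metis oddE)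
qed

lemma two_gens_even_len:
  assumes "a \<in> T" "b \<in> T" "w \<in> generate G {a, b}"
  shows "even (cox_len G {a, b} w) \<longleftrightarrow> even (len w)"
proof -
  obtain x y where xy: "x = a \<and> y = b \<or> x = b \<and> y = a" "w = wprod G (alt_word x y (cox_len G {a, b} w))"
    using assms by (rule two_gens_reduced)
  then have "x \<in> T" "y \<in> T" using assms by auto
  then show ?thesis using xy even_len_alt_word by metis
qed

lemma one_not_T: "\<one> \<notin> T"
  using odd_len_T [of \<one>] by auto

section \<open>Two reflections generate a subgroup with exactly two canonical generators\<close>

lemma inversions_canonical_mult:
  assumes "subgroup H G" "x \<in> canonical_gens G S H" "w \<in> carrier G" "d \<in> T" "d \<in> H"
  shows "d \<in> inversions (x \<otimes> w) \<longleftrightarrow> (d = x) \<noteq> (x \<otimes> d \<otimes> x \<in> inversions w)"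
proof -
  have "x \<in> T" "d \<in> inversions x \<longleftrightarrow> d = x"
    using assms by (auto simp: canonical_gens_iff)
  then show ?thesis using inversions_mult [of x w d] assms by simp
qed

text \<open>If c = bab, then b not being an inversion of c forces b into N(ab), hence aba into N(b),
  so aba = b. Then a and b commute and c = a, a contradiction.\<close>

lemma canonical_gens_conj_neq:
  assumes H: "subgroup H G" and abc: "{a, b, c} \<subseteq> canonical_gens G S H"
    and neq: "a \<noteq> b" "b \<noteq> c" "a \<noteq> c"
  shows "b \<otimes> a \<otimes> b \<noteq> c"
proof
  assume c: "b \<otimes> a \<otimes> b = c"
  have T: "a \<in> T" "b \<in> T" "c \<in> T" "a \<in> H" "b \<in> H" "c \<in> H"
    using abc canonical_gens_subset [of H] by auto
  have "b \<notin> inversions c" using abc neq T by (auto simp: canonical_gens_iff)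
  then have "b \<notin> inversions (b \<otimes> (a \<otimes> b))" using c T by (simp add: m_assoc)
  then have "b \<in> inversions (a \<otimes> b)"
    using inversions_canonical_mult [OF H, of b "a \<otimes> b" b] abc T by (simp add: m_assoc)
  then have "a \<otimes> b \<otimes> a \<in> inversions b"
    using inversions_canonical_mult [OF H, of a b b] abc T neq by simp
  moreover have "a \<otimes> b \<otimes> a \<in> H" using T H by (simp add: subgroup.m_closed)
  ultimately have "a \<otimes> b \<otimes> a = b" using abc by (auto simp: canonical_gens_iff)
  then have "a \<otimes> (a \<otimes> b \<otimes> a) = a \<otimes> b" by simp
  then have "b \<otimes> a = a \<otimes> b" using T by (simp add: m_assoc)
  then have "c = a \<otimes> b \<otimes> b" using c by simp
  then show False using T neq by (simp add: m_assoc)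
qed

text \<open>In a group generated by two reflections the odd element \<open>abc\<close> is an involution, and
  comparing the inversion sets of \<open>abc\<close> and \<open>cba\<close> gives \<open>c = bacab\<close>, hence
  \<open>cab = abc = cba\<close>.\<close>

lemma canonical_gens_commute:
  assumes "t \<in> T" "r \<in> T" and H: "H = generate G {t, r}"
    and abc: "{a, b, c} \<subseteq> canonical_gens G S H" and neq: "a \<noteq> b" "b \<noteq> c" "a \<noteq> c"
  shows "a \<otimes> b = b \<otimes> a"
proof -
  have sub: "subgroup H G" unfolding H using assms by (intro generate_is_subgroup) auto
  have T: "a \<in> T" "b \<in> T" "c \<in> T" "a \<in> H" "b \<in> H" "c \<in> H"
    using abc canonical_gens_subset [of H] by auto
  have inH: "x \<otimes> y \<in> H" if "x \<in> H" "y \<in> H" for x y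
    using that sub by (simp add: subgroup.m_closed)
  have "odd (len (a \<otimes> b \<otimes> c))" using T by (simp add: even_len_mult odd_len_T)
  then have "a \<otimes> b \<otimes> c \<in> T"
    using two_gens_odd_reflection [OF assms(1,2), folded H] T inH by simp
  then have "a \<otimes> b \<otimes> c = inv (a \<otimes> b \<otimes> c)" by simp
  also have "\<dots> = c \<otimes> (b \<otimes> a)" using T by (simp add: inv_mult_group)
  finally have abc_cba: "a \<otimes> b \<otimes> c = c \<otimes> (b \<otimes> a)" .
  have bcb: "b \<otimes> c \<otimes> b \<noteq> a" and aca: "a \<otimes> c \<otimes> a \<noteq> b"
    using canonical_gens_conj_neq [OF sub, of c b a] canonical_gens_conj_neq [OF sub, of c a b]
      abc neq by auto
  have "b \<otimes> c \<otimes> b \<notin> inversions a"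
    using bcb abc T inH by (auto simp: canonical_gens_iff)
  then have "c \<notin> inversions (b \<otimes> a)"
    using inversions_canonical_mult [OF sub, of b a c] abc T neq by auto
  then have "c \<in> inversions (c \<otimes> (b \<otimes> a))"
    using inversions_canonical_mult [OF sub, of c "b \<otimes> a" c] abc T by (simp add: m_assoc)
  then have "c \<in> inversions (a \<otimes> (b \<otimes> c))" using abc_cba T by (simp add: m_assoc)
  then have "a \<otimes> c \<otimes> a \<in> inversions (b \<otimes> c)"
    using inversions_canonical_mult [OF sub, of a "b \<otimes> c" c] abc T neq by auto
  moreover have "a \<otimes> c \<otimes> a \<in> T" using T_conj [of c a] T by simp
  ultimately have "b \<otimes> (a \<otimes> c \<otimes> a) \<otimes> b \<in> inversions c"
    using inversions_canonical_mult [OF sub, of b c "a \<otimes> c \<otimes> a"] abc T inH aca by auto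
  moreover have "b \<otimes> (a \<otimes> c \<otimes> a) \<otimes> b \<in> H" using T inH by simp
  ultimately have "b \<otimes> (a \<otimes> c \<otimes> a) \<otimes> b = c" using abc by (auto simp: canonical_gens_iff)
  then have "a \<otimes> (b \<otimes> (b \<otimes> (a \<otimes> c \<otimes> a) \<otimes> b)) = a \<otimes> b \<otimes> c" using T by (simp add: m_assoc)
  then have "c \<otimes> (a \<otimes> b) = a \<otimes> b \<otimes> c" using T by (simp add: m_assoc)
  then have "c \<otimes> (a \<otimes> b) = c \<otimes> (b \<otimes> a)" using abc_cba by simp
  then show ?thesis using T by simp
qed

lemma generate_commuting_reflections:
  assumes "t \<in> T" "r \<in> T" "t \<otimes> r = r \<otimes> t"
  shows "generate G {t, r} \<subseteq> {\<one>, t, r, t \<otimes> r}"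
proof
  have rt: "r \<otimes> (t \<otimes> x) = t \<otimes> (r \<otimes> x)" if "x \<in> carrier G" for x
    using that assms by (simp add: m_assoc [symmetric])
  fix w assume "w \<in> generate G {t, r}"
  then show "w \<in> {\<one>, t, r, t \<otimes> r}"
    by (induction rule: generate.induct)
      (use assms(1,2) in \<open>auto simp: m_assoc rt assms(3) [symmetric]\<close>)
qed

text \<open>A single canonical generator would leave only one reflection in \<open>H\<close>. With
  three or more, all commute by \<open>canonical_gens_commute\<close>, so every reflection of
  \<open>H\<close> is canonical; then t and r commute and H consists of 1, t, r and tr. As tr has
  even length, only two reflections remain.\<close>

lemma canonical_gens_dihedral:
  assumes "t \<in> T" "r \<in> T" "t \<noteq> r" and H: "H = generate G {t, r}"
  obtains a b where "a \<noteq> b" "canonical_gens G S H = {a, b}"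
proof -
  let ?C = "canonical_gens G S H"
  have sub: "subgroup H G" unfolding H using assms by (intro generate_is_subgroup) auto
  have gen: "generate G ?C = H" unfolding H using assms by (intro generate_canonical_gens) auto
  have tr: "t \<in> H" "r \<in> H" unfolding H by (auto intro: generate.incl)
  have CT: "x \<in> T" if "x \<in> ?C" for x using that canonical_gens_subset [of H] by auto
  have "\<exists>a\<in>?C. \<exists>b\<in>?C. a \<noteq> b"
  proof (rule ccontr)
    assume "\<not> ?thesis"
    moreover obtain a where a: "a \<in> ?C"
      using reflection_conj_canonical [OF sub assms(1) tr(1)] by blast
    ultimately have C: "?C = {a}" by blast
    have "w \<in> {\<one>, a}" if "w \<in> generate G ?C" for w
      using that unfolding C
      by (induction rule: generate.induct) (use CT [OF a] in auto)
    then have "t \<in> {\<one>, a}" "r \<in> {\<one>, a}" using gen tr by auto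
    then show False using assms one_not_T by auto
  qed
  then obtain a b where ab: "a \<in> ?C" "b \<in> ?C" "a \<noteq> b" by blast
  have "?C \<subseteq> {a, b}"
  proof (rule ccontr)
    assume "\<not> ?thesis"
    then obtain c where c: "c \<in> ?C" "c \<noteq> a" "c \<noteq> b" by blast
    have comm: "x \<otimes> y = y \<otimes> x" if "x \<in> ?C" "y \<in> ?C" for x y
    proof (cases "x = y")
      case False
      obtain z where "z \<in> {a, b, c}" "z \<noteq> x" "z \<noteq> y" using ab c by blast
      then show ?thesis
        using canonical_gens_commute [OF assms(1,2) H, of x y z] that ab c False by auto
    qed simp
    have commH: "w \<otimes> x = x \<otimes> w" if "w \<in> generate G ?C" "x \<in> ?C" for w x
      using that(1)
    proof (induction rule: generate.induct)
      case (eng u v)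
      have uv: "u \<in> carrier G" "v \<in> carrier G"
        using eng.hyps gen subgroup.subset [OF sub] by auto
      have "u \<otimes> v \<otimes> x = u \<otimes> (x \<otimes> v)" using uv CT [OF that(2)] eng.IH by (simp add: m_assoc)
      also have "\<dots> = x \<otimes> u \<otimes> v" using uv CT [OF that(2)] eng.IH by (simp add: m_assoc [symmetric])
      finally show ?case using uv CT [OF that(2)] by (simp add: m_assoc)
    next
      case (inv h)
      then show ?case using comm [OF inv that(2)] CT [of h] by simp
    qed (use comm [OF _ that(2)] CT [OF that(2)] in auto)
    have T_C: "d \<in> ?C" if d: "d \<in> T" "d \<in> H" for d
    proof -
      obtain h e where he: "h \<in> generate G ?C" "e \<in> ?C" "d = h \<otimes> e \<otimes> inv h"
        using reflection_conj_canonical [OF sub d] .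
      then have h: "h \<in> H" "h \<in> carrier G" using gen subgroup.subset [OF sub] by auto
      then have "d = e" using he commH [OF he(1,2)] CT [of e] by (simp add: m_assoc)
      then show ?thesis using he by simp
    qed
    have "t \<otimes> r = r \<otimes> t" using comm T_C assms tr by simp
    then have HS: "H \<subseteq> {\<one>, t, r, t \<otimes> r}"
      unfolding H by (rule generate_commuting_reflections [OF assms(1,2)])
    have "even (len (t \<otimes> r))" using assms(1,2) by (simp add: even_len_mult odd_len_T)
    then have "t \<otimes> r \<notin> T" using odd_len_T by blast
    then have "?C \<subseteq> {t, r}" using HS canonical_gens_subset [of H] one_not_T by blast
    then show False using ab c by blast
  qed
  then show ?thesis using that ab by blast
qed

end

section \<open>Dihedral reflection subgroups\<close>

text \<open>The assumption \<open>canonical\<close> puts \<open>a\<close> and \<open>b\<close> in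
  the situation of \<open>exchange\<close>, so inversions lying in the subgroup can be read off from
  word length in these two generators.\<close>

locale dihedral_subgroup = coxeter +
  fixes a b
  assumes gens_T: "a \<in> T" "b \<in> T" and gens_neq: "a \<noteq> b"
    and canonical: "canonical_gens G S (generate G {a, b}) = {a, b}"
begin

abbreviation H where "H \<equiv> generate G {a, b}"
abbreviation dlen where "dlen \<equiv> cox_len G {a, b}"

lemma gens_involutions: "involutions {a, b}"
  using gens_T by (intro involutions_subset_T) auto

lemma H_subgroup: "subgroup H G"
  using gens_T by (intro generate_is_subgroup) auto

lemma H_closed [simp]: "x \<in> H \<Longrightarrow> x \<in> carrier G"
  using H_subgroup subgroup.subset by blast

lemma H_mult [simp]: "x \<in> H \<Longrightarrow> y \<in> H \<Longrightarrow> x \<otimes> y \<in> H"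
  and H_inv [simp]: "x \<in> H \<Longrightarrow> inv x \<in> H"
  using H_subgroup by (simp_all add: subgroup.m_closed subgroup.m_inv_closed)

lemma gens_H [simp]: "a \<in> H" "b \<in> H"
  by (auto intro: generate.incl)

lemma dihedral_H: "dihedral_refl_subgroup G S H"
  using gens_T gens_neq canonical
  by (auto simp: dihedral_refl_subgroup_def reflection_subgroup_def)

lemma inversions_dlen:
  assumes "w \<in> H" "c \<in> T" "c \<in> H"
  shows "c \<in> inversions w \<longleftrightarrow> dlen (c \<otimes> w) < dlen w"
proof (rule exchange)
  show "inversions x \<inter> H = {x}" if "x \<in> {a, b}" for x
    using that canonical canonical_gens_iff [of x H] by auto
qed (use gens_T assms in auto)

lemma not_inversions_dlen:
  assumes "w \<in> H" "c \<in> T" "c \<in> H"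
  shows "c \<notin> inversions w \<longleftrightarrow> dlen w < dlen (c \<otimes> w)"
  using inversions_dlen [of "c \<otimes> w" c] inversions_mult_self [of c w] assms by simp

lemma even_dlen: "w \<in> H \<Longrightarrow> even (dlen w) \<longleftrightarrow> even (len w)"
  using two_gens_even_len gens_T by simp

lemma even_dlen_mult: "x \<in> H \<Longrightarrow> y \<in> H \<Longrightarrow> even (dlen (x \<otimes> y)) \<longleftrightarrow> (even (dlen x) \<longleftrightarrow> even (dlen y))"
  by (simp add: even_dlen even_len_mult)

lemma even_dlen_inv: "x \<in> H \<Longrightarrow> even (dlen (inv x)) \<longleftrightarrow> even (dlen x)"
  by (simp add: even_dlen even_len_inv)

lemma odd_dlen_reflection: "w \<in> H \<Longrightarrow> odd (dlen w) \<longleftrightarrow> w \<in> T"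
  using two_gens_odd_reflection [OF gens_T, of w] odd_len_T [of w] even_dlen [of w] by blast

text \<open>Opposite parities make the quotient a reflection, and whether it is an inversion of
  \<open>u\<close> can be tested with \<open>dlen\<close> as well as with
  \<open>len\<close>.\<close>

lemma bruhat_arrow_on_H:
  assumes "u \<in> H" "v \<in> H" "even (dlen u) \<noteq> even (dlen v)" "dlen u < dlen v"
  shows "bruhat_arrow_on G S H u v"
proof -
  define c where "c = v \<otimes> inv u"
  have c: "c \<in> H" "c \<otimes> u = v" using assms by (auto simp: c_def m_assoc)
  moreover have "c \<in> T" "u \<otimes> inv v \<in> T"
    using assms by (auto simp: c_def odd_dlen_reflection [symmetric] even_dlen_mult even_dlen_inv)
  ultimately have "len u < len v"
    using not_inversions_dlen [of u c] not_inversions_iff [of u c] assms by simp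
  then have "bruhat_step G S u v"
    using assms c \<open>c \<in> T\<close> by (auto simp: bruhat_step_def)
  then show ?thesis
    using assms \<open>u \<otimes> inv v \<in> T\<close>
    by (auto simp: bruhat_arrow_on_def bruhat_arrow_def bruhat_lt_def bruhat_le_def)
qed

lemma dlen_alt_word_le:
  "x \<in> {a, b} \<Longrightarrow> y \<in> {a, b} \<Longrightarrow> dlen (wprod G (alt_word x y n)) \<le> n"
  using cox_len_wprod_le [of "alt_word x y n" "{a, b}"] alt_word_in_lists [of x "{a, b}" y n] by simp

lemma alt_word_H [simp]: "x \<in> {a, b} \<Longrightarrow> y \<in> {a, b} \<Longrightarrow> wprod G (alt_word x y n) \<in> H"
  using generate_eq_wprod [OF gens_involutions] alt_word_in_lists [of x "{a, b}" y n] by blast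

lemma dlen_gen_le: "x \<in> {a, b} \<Longrightarrow> dlen x \<le> 1"
  by (rule cox_len_gen_le [OF gens_involutions])

lemma dlen_mult_le: "x \<in> H \<Longrightarrow> y \<in> H \<Longrightarrow> dlen (x \<otimes> y) \<le> dlen x + dlen y"
  by (rule cox_len_mult_le [OF gens_involutions])

lemma dlen_inv_le: "x \<in> H \<Longrightarrow> dlen (inv x) \<le> dlen x"
  by (rule cox_len_inv_le [OF gens_involutions])

lemma reduced_tail:
  assumes "x \<in> {a, b}" "y \<in> {a, b}" "dlen (wprod G (alt_word x y (Suc n))) = Suc n"
  shows "dlen (wprod G (alt_word y x n)) = n"
proof -
  have "dlen (wprod G (alt_word x y (Suc n))) \<le> dlen x + dlen (wprod G (alt_word y x n))"
    using assms dlen_mult_le [of x "wprod G (alt_word y x n)"] by auto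
  then show ?thesis
    using assms dlen_gen_le [of x] dlen_alt_word_le [of y x n] by simp
qed

text \<open>Both reflections have odd length, so no single arrow joins them. The path passes through
  the tail of a reduced word of \<open>t\<close>, an element of even length one below
  \<open>t\<close> and, by parity, still above \<open>t'\<close>.\<close>

lemma refl_sq_if_dlen_less:
  assumes "t \<in> T" "t \<in> H" "t' \<in> T" "t' \<in> H" "dlen t' < dlen t"
  shows "refl_sq G S t' t"
proof -
  obtain x y where xy: "x = a \<and> y = b \<or> x = b \<and> y = a" "t = wprod G (alt_word x y (dlen t))"
    using two_gens_reduced [OF gens_T assms(2)] by blast
  obtain n where n: "dlen t = Suc n" using assms(5) gr0_implies_Suc by (metis gr_implies_not0 neq0_conv)
  define w where "w = wprod G (alt_word y x n)"
  have w: "dlen w = n" "w \<in> H"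
    using reduced_tail [of x y n] xy n by (auto simp: w_def)
  have par: "odd (dlen t)" "odd (dlen t')" using assms by (auto simp: odd_dlen_reflection)
  have ne: "dlen t' \<noteq> n" using par n by auto
  have "bruhat_arrow_on G S H t' w"
    by (rule bruhat_arrow_on_H) (use w par n ne assms in auto)
  moreover have "bruhat_arrow_on G S H w t"
    by (rule bruhat_arrow_on_H) (use w par n assms in auto)
  ultimately have "(bruhat_arrow_on G S H)\<^sup>*\<^sup>* t' t" by auto
  then show ?thesis
    unfolding refl_sq_def using assms dihedral_H
    by (intro tranclp.r_into_trancl) (auto simp: refl_sq'_def)
qed

text \<open>The left factor equals its inverse, so the common prefix of the two alternating words
  cancels. The bound is the distance between \<open>k\<close> and \<open>n\<close>, written with
  truncated subtraction.\<close>

lemma dlen_reflection_mult_alt_word: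
  assumes xy: "x \<in> {a, b}" "y \<in> {a, b}" and "wprod G (alt_word x y k) \<in> T"
  shows "dlen (wprod G (alt_word x y k) \<otimes> wprod G (alt_word x y n)) \<le> (k - n) + (n - k)"
proof -
  let ?w = "\<lambda>n. wprod G (alt_word x y n)"
  have xyT: "x \<in> T" "y \<in> T" using xy gens_T by auto
  have split: "\<exists>v\<in>H. dlen v \<le> j - i \<and> ?w j = ?w i \<otimes> v" if "i \<le> j" for i j
  proof -
    let ?v = "if even i then alt_word x y (j - i) else alt_word y x (j - i)"
    have "alt_word x y j = alt_word x y i @ ?v" using alt_word_add [of x y i "j - i"] that by simp
    moreover have "?v \<in> lists (carrier G)" "alt_word x y i \<in> lists (carrier G)" using xyT by auto
    ultimately have "?w j = ?w i \<otimes> wprod G ?v" by (simp only: wprod_append)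
    moreover have "wprod G ?v \<in> H" "dlen (wprod G ?v) \<le> j - i"
      using xy alt_word_H dlen_alt_word_le by auto
    ultimately show ?thesis by blast
  qed
  show ?thesis
  proof (cases "k \<le> n")
    case True
    then obtain v where v: "v \<in> H" "dlen v \<le> n - k" "?w n = ?w k \<otimes> v" using split by blast
    then have "?w k \<otimes> ?w n = v" using assms by simp
    then show ?thesis using v by simp
  next
    case False
    then obtain v where v: "v \<in> H" "dlen v \<le> k - n" "?w k = ?w n \<otimes> v" using split [of n k] by auto
    have "?w k = inv (?w k)" using assms by simp
    also have "\<dots> = inv v \<otimes> inv (?w n)" using v xyT by (simp add: inv_mult_group)
    finally have "?w k \<otimes> ?w n = inv v" using v xyT by (simp add: m_assoc)
    then show ?thesis using v dlen_inv_le [of v] by simp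
  qed
qed

text \<open>Ascent is expressed by \<open>inversions\<close> because this condition translates both
  into \<open>dlen\<close> on \<open>H\<close> and into \<open>len\<close> on a coset of
  \<open>H\<close>.\<close>

definition H_step :: "'a set \<Rightarrow> 'a \<Rightarrow> 'a \<Rightarrow> bool" where
  "H_step R u v \<longleftrightarrow> u \<in> H \<and> (\<exists>c \<in> R \<inter> T \<inter> H. v = c \<otimes> u \<and> c \<notin> inversions u)"

text \<open>Prepending letters one at a time climbs from a suffix to the full reduced word by
  reflections \<open>a\<close> and \<open>b\<close>. The parity of \<open>i\<close> decides the
  first letter of the suffix.\<close>

lemma suffix_chain:
  assumes "a \<in> R" "b \<in> R" "x \<in> {a, b}" "y \<in> {a, b}" "dlen (wprod G (alt_word x y (i + n))) = i + n"
  shows "dlen (wprod G (if even i then alt_word x y n else alt_word y x n)) = n \<and>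
    (H_step R)\<^sup>*\<^sup>* (wprod G (if even i then alt_word x y n else alt_word y x n))
      (wprod G (alt_word x y (i + n)))"
  using assms(3-)
proof (induction i arbitrary: x y)
  case (Suc i)
  let ?w = "wprod G (alt_word y x (i + n))"
  have len: "dlen ?w = i + n" using reduced_tail [of x y "i + n"] Suc.prems by simp
  have w: "?w \<in> H" using Suc.prems by simp
  have x: "x \<in> R" "x \<in> T" "x \<in> H" using Suc.prems assms gens_T by auto
  have "H_step R ?w (x \<otimes> ?w)"
    unfolding H_step_def using x w len Suc.prems not_inversions_dlen [OF w x(2,3)] by auto
  then show ?case using Suc.IH [OF Suc.prems(2,1) len]
    by (auto intro: rtranclp.rtrancl_into_rtrancl)
qed simp

text \<open>If \<open>w\<close> is a suffix of the reduced word of q = trw, prepend letters.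
  Otherwise \<open>w\<close> belongs to the other alternating family, and one jump leads to the
  suffix of q that is one letter longer than \<open>w\<close>; the length bound on \<open>t\<close>
  puts the reflection used for the jump into \<open>R\<close>.\<close>

lemma dihedral_chain:
  assumes R: "order_ideal_T G S R" and t: "t \<in> R" "t \<in> H" and r: "r \<in> T" "r \<in> H"
    and w: "w \<in> H"
    and less: "dlen w < dlen (r \<otimes> w)" "dlen (r \<otimes> w) < dlen (t \<otimes> (r \<otimes> w))"
      "dlen (t \<otimes> (r \<otimes> w)) < dlen (t \<otimes> w)"
  shows "(H_step R)\<^sup>*\<^sup>* w (t \<otimes> (r \<otimes> w))"
proof -
  define q where "q = t \<otimes> (r \<otimes> w)"
  define p m k where "p = dlen w" and "m = dlen q" and "k = dlen t"
  have tT: "t \<in> T" using R t by (auto simp: order_ideal_T_def)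
  have qH: "q \<in> H" using t r w by (simp add: q_def)
  have par: "odd (dlen t)" "odd (dlen r)" using t r tT by (auto simp: odd_dlen_reflection)
  then have even_mp: "even m \<longleftrightarrow> even p"
    using t r w by (simp add: m_def p_def q_def even_dlen_mult)
  have mp: "p + 2 \<le> m" using less by (simp add: m_def p_def q_def)
  have twk: "dlen (t \<otimes> w) \<le> k + p" using t w dlen_mult_le by (simp add: k_def p_def)
  \<comment> \<open>The parity gap gives p + 3 <= m + 1 <= \<open>dlen (t \<otimes> w)\<close> <= k
    + p. Thus \<open>t\<close> is longer than the generators, which therefore lie in
    \<open>R\<close>.\<close>
  have k3: "3 \<le> k" using twk less mp by (simp add: m_def q_def)
  have below: "c \<in> R" if "c \<in> T" "c \<in> H" "dlen c < k" for c
    using refl_sq_if_dlen_less [OF tT t(2) that(1,2)] that(3) R t(1)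
    by (auto simp: order_ideal_T_def k_def)
  have abR: "a \<in> R" "b \<in> R"
    using below [of a] below [of b] gens_T dlen_gen_le [of a] dlen_gen_le [of b] k3 by auto
  obtain x y where xy: "x = a \<and> y = b \<or> x = b \<and> y = a" and q: "q = wprod G (alt_word x y m)"
    using two_gens_reduced [OF gens_T qH] unfolding m_def by metis
  then have xyab: "x \<in> {a, b}" "y \<in> {a, b}" by auto
  have chain: "dlen (wprod G (if even i then alt_word x y n else alt_word y x n)) = n"
      "(H_step R)\<^sup>*\<^sup>* (wprod G (if even i then alt_word x y n else alt_word y x n)) q"
    if "i + n = m" for i n
  proof -
    have "dlen (wprod G (alt_word x y (i + n))) = i + n"
      unfolding that using q m_def by metis
    from suffix_chain [OF abR xyab this]
    show "dlen (wprod G (if even i then alt_word x y n else alt_word y x n)) = n"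
      "(H_step R)\<^sup>*\<^sup>* (wprod G (if even i then alt_word x y n else alt_word y x n)) q"
      by (simp_all only: that q)
  qed
  obtain x' y' where xy': "x' = a \<and> y' = b \<or> x' = b \<and> y' = a" "w = wprod G (alt_word x' y' p)"
    using two_gens_reduced [OF gens_T w] unfolding p_def by metis
  then consider (same) "w = wprod G (alt_word x y p)" | (opp) "w = wprod G (alt_word y x p)"
    using xy by auto
  then have "(H_step R)\<^sup>*\<^sup>* w q"
  proof cases
    case same
    then show ?thesis using chain(2) [of "m - p" p] mp even_mp by simp
  next
    case opp
    \<comment> \<open>The reduced word of \<open>t\<close> starts like that of q or like that of
      \<open>w\<close>. If k were at most 2p + 1, cancelling the common prefix would make
      \<open>t \<otimes> q\<close>, which is \<open>r \<otimes> w\<close>, or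
      \<open>t \<otimes> w\<close> too short.\<close>
    have "2 * p + 1 < k"
    proof (rule ccontr)
      assume small: "\<not> 2 * p + 1 < k"
      obtain x'' y'' where xy'': "x'' = a \<and> y'' = b \<or> x'' = b \<and> y'' = a"
        "t = wprod G (alt_word x'' y'' k)"
        using two_gens_reduced [OF gens_T t(2)] unfolding k_def by metis
      then consider "t = wprod G (alt_word x y k)" | "t = wprod G (alt_word y x k)"
        using xy by auto
      then show False
      proof cases
        case 1
        have "t \<otimes> q = r \<otimes> w" using tT r w by (simp add: q_def)
        then have "dlen (r \<otimes> w) \<le> (k - m) + (m - k)"
          using dlen_reflection_mult_alt_word [OF xyab, of k m] 1 q tT by simp
        then show False using small less mp twk by (simp add: q_def m_def p_def)
      next
        case 2
        then have "dlen (t \<otimes> w) \<le> (k - p) + (p - k)"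
          using dlen_reflection_mult_alt_word [OF xyab(2,1), of k p] opp tT by simp
        then show False using small less mp by (simp add: q_def m_def p_def)
      qed
    qed
    \<comment> \<open>Since m - p - 1 is odd, this is the suffix of q with p + 1 letters; it also
      extends \<open>w\<close> by one letter on the right, so the reflection from \<open>w\<close>
      to it has length at most 2p + 1.\<close>
    define v where "v = wprod G (alt_word y x (p + 1))"
    have v: "dlen v = p + 1" "(H_step R)\<^sup>*\<^sup>* v q"
      using chain [of "m - p - 1" "p + 1"] mp even_mp by (auto simp: v_def)
    have vH: "v \<in> H" unfolding v_def by (intro alt_word_H xyab)
    define g where "g = v \<otimes> inv w"
    have g: "g \<in> H" "g \<otimes> w = v" using vH w by (auto simp: g_def m_assoc)
    have gT: "g \<in> T"
      using vH w v(1) by (simp add: g_def odd_dlen_reflection [symmetric] even_dlen_mult even_dlen_inv p_def)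
    have "dlen g \<le> 2 * p + 1"
      using dlen_mult_le [of v "inv w"] dlen_inv_le [OF w] vH w v(1) by (simp add: g_def p_def)
    then have "g \<in> R" using below gT g \<open>2 * p + 1 < k\<close> by simp
    moreover have "g \<notin> inversions w"
      using not_inversions_dlen [OF w gT g(1)] g v(1) by (simp add: p_def)
    ultimately have "H_step R w v" using w g gT by (auto simp: H_step_def)
    then show ?thesis using v(2) by (rule converse_rtranclp_into_rtranclp)
  qed
  then show ?thesis by (simp add: q_def)
qed

end

section \<open>Projections to minimal coset representatives\<close>

context coxeter
begin

definition up_step :: "'a set \<Rightarrow> 'a \<Rightarrow> 'a \<Rightarrow> bool" where
  "up_step R u v \<longleftrightarrow> u \<in> carrier G \<and> (\<exists>t\<in>R. v = t \<otimes> u \<and> len u < len v)"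

lemma bruhat_lt_len:
  assumes "bruhat_lt G S u v" shows "len u < len v"
proof -
  have "(bruhat_step G S)\<^sup>*\<^sup>* u v" "u \<noteq> v"
    using assms by (auto simp: bruhat_lt_def bruhat_le_def)
  moreover have "u = v \<or> len u < len v" if "(bruhat_step G S)\<^sup>*\<^sup>* u v"
    using that by (induction rule: rtranclp_induct) (auto simp: bruhat_step_def)
  ultimately show ?thesis by blast
qed

text \<open>For left multiplication by a reflection, Bruhat comparison amounts to comparing lengths,
  so chains can be checked by length alone.\<close>

lemma LX_step_iff:
  assumes "R \<subseteq> T" "u \<in> carrier G"
  shows "LX_step G S R u v \<longleftrightarrow> up_step R u v"
proof
  assume "up_step R u v"
  then obtain t where t: "t \<in> R" "t \<in> T" "v = t \<otimes> u" "len u < len v"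
    using assms by (auto simp: up_step_def)
  then have "bruhat_step G S u v" using assms by (auto simp: bruhat_step_def)
  then show "LX_step G S R u v"
    using t assms by (auto simp: LX_step_def bruhat_lt_def bruhat_le_def)
qed (use assms bruhat_lt_len in \<open>auto simp: LX_step_def up_step_def\<close>)

lemma up_step_closed:
  assumes "R \<subseteq> T" "(up_step R)\<^sup>*\<^sup>* u v" "u \<in> carrier G" shows "v \<in> carrier G"
  using assms(2,3) by (induction rule: rtranclp_induct) (use assms(1) in \<open>auto simp: up_step_def\<close>)

lemma le_LX_iff:
  assumes "R \<subseteq> T" "u \<in> carrier G"
  shows "le_LX G S R u v \<longleftrightarrow> (up_step R)\<^sup>*\<^sup>* u v"
proof
  assume "le_LX G S R u v"
  moreover have "(up_step R)\<^sup>*\<^sup>* u v" if "(LX_step G S R)\<^sup>+\<^sup>+ u v"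
    using that
  proof (induction rule: tranclp_induct)
    case (base y)
    then show ?case using LX_step_iff assms by blast
  next
    case (step y z)
    then show ?case
      using LX_step_iff [OF assms(1)] up_step_closed [OF assms(1) _ assms(2)]
      by (meson rtranclp.rtrancl_into_rtrancl)
  qed
  ultimately show "(up_step R)\<^sup>*\<^sup>* u v" by (auto simp: le_LX_def)
next
  assume "(up_step R)\<^sup>*\<^sup>* u v"
  then show "le_LX G S R u v"
  proof (induction rule: rtranclp_induct)
    case (step y z)
    have "LX_step G S R y z" "len y < len z"
      using step.hyps LX_step_iff [OF assms(1), of y z] by (auto simp: up_step_def)
    then show ?case using step.IH by (auto simp: le_LX_def)
  qed (simp add: le_LX_def)
qed

lemma len_mult_S:
  assumes "x \<in> carrier G" "s \<in> S"
  shows "len (x \<otimes> s) = len x + 1 \<or> len x = len (x \<otimes> s) + 1"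
proof -
  have le: "len (z \<otimes> s) \<le> len z + 1" if "z \<in> carrier G" for z
    using cox_len_mult_le [OF S_involutions, of z s] cox_len_gen_le [OF S_involutions, of s]
      that assms by (simp add: S_generate)
  have "even (len (x \<otimes> s)) \<noteq> even (len x)"
    using assms by (simp add: even_len_mult odd_len_S)
  then have "len (x \<otimes> s) \<noteq> len x" by auto
  moreover have "len x \<le> len (x \<otimes> s) + 1"
    using le [of "x \<otimes> s"] assms by (simp add: m_assoc)
  ultimately show ?thesis using le [OF assms(1)] by linarith
qed

text \<open>Since rx = xs for r = x s x^-1, right multiplication by \<open>s\<close> becomes left
  multiplication by a reflection, and all four elements lie in the coset Hx of the subgroup
  generated by t and r. Removing its minimal element y turns the hypotheses into those of
  \<open>dihedral_chain\<close>; multiplying the chain by y brings it back.\<close>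

lemma up_chain:
  assumes R: "order_ideal_T G S R" and t: "t \<in> R" and x: "x \<in> carrier G" and s: "s \<in> S"
    and less: "len x < len (x \<otimes> s)" "len (x \<otimes> s) < len (t \<otimes> (x \<otimes> s))"
      "len (t \<otimes> (x \<otimes> s)) < len (t \<otimes> x)"
  shows "(up_step R)\<^sup>*\<^sup>* x (t \<otimes> (x \<otimes> s))"
proof -
  define r where "r = x \<otimes> s \<otimes> inv x"
  have tT: "t \<in> T" using R t by (auto simp: order_ideal_T_def)
  have rT: "r \<in> T" using x s T_conj S_subset_T by (simp add: r_def)
  have rx: "r \<otimes> x = x \<otimes> s" using x s by (simp add: r_def m_assoc)
  have "t \<noteq> r"
  proof
    assume "t = r"
    then have "t \<otimes> (x \<otimes> s) = x" using rx rT x by (simp flip: rx)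
    then show False using less by simp
  qed
  then obtain a b where ab: "a \<noteq> b" "canonical_gens G S (generate G {t, r}) = {a, b}"
    using canonical_gens_dihedral [OF tT rT _ refl] by metis
  have gen: "generate G {a, b} = generate G {t, r}"
    using generate_canonical_gens [of "{t, r}"] ab tT rT by simp
  interpret dihedral_subgroup G S a b
  proof
    show "a \<in> T" "b \<in> T" using ab canonical_gens_subset [of "generate G {t, r}"] by auto
    show "a \<noteq> b" by fact
    show "canonical_gens G S (generate G {a, b}) = {a, b}" using ab gen by simp
  qed
  have trH: "t \<in> H" "r \<in> H" unfolding gen by (auto intro: generate.incl)
  obtain h y where hy: "h \<in> H" "y \<in> carrier G" "x = h \<otimes> y" "inversions y \<inter> H = {}"
    using min_coset_rep [OF H_subgroup x] unfolding canonical by blast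
  have coset: "c \<notin> inversions g \<longleftrightarrow> len (g \<otimes> y) < len (c \<otimes> (g \<otimes> y))"
    if "g \<in> H" "c \<in> T" "c \<in> H" for c g
    using inversions_coset [OF H_subgroup hy(2,4) that] not_inversions_iff [of "g \<otimes> y" c] that hy
    by simp
  have dcoset: "dlen g < dlen (c \<otimes> g) \<longleftrightarrow> len (g \<otimes> y) < len (c \<otimes> (g \<otimes> y))"
    if "g \<in> H" "c \<in> T" "c \<in> H" for c g
    using coset [OF that] not_inversions_dlen [OF that] by simp
  have l1: "dlen h < dlen (r \<otimes> h)"
    using dcoset [OF hy(1) rT trH(2)] less(1) rx hy by simp
  have l2: "dlen (r \<otimes> h) < dlen (t \<otimes> (r \<otimes> h))"
    using dcoset [of "r \<otimes> h" t] less(2) trH hy tT rx [symmetric] by (simp add: m_assoc)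
  have l3: "dlen (t \<otimes> (r \<otimes> h)) < dlen (t \<otimes> h)"
  proof -
    \<comment> \<open>The reflection trt carries trh to th, so this comparison also has the form
      required by \<open>dcoset\<close>.\<close>
    have "t \<otimes> r \<otimes> t \<in> T" "t \<otimes> r \<otimes> t \<in> H" "t \<otimes> (r \<otimes> h) \<in> H"
      using T_conj [OF rT, of t] tT trH hy by auto
    from dcoset [OF this(3,1,2)] show ?thesis
      using less(3) trH hy tT rT rx [symmetric] by (simp add: m_assoc)
  qed
  have "(H_step R)\<^sup>*\<^sup>* h (t \<otimes> (r \<otimes> h))"
    using dihedral_chain [OF R t trH(1) rT trH(2) hy(1) l1 l2 l3] .
  then have "(up_step R)\<^sup>*\<^sup>* (h \<otimes> y) (t \<otimes> (r \<otimes> h) \<otimes> y)"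
  proof (induction rule: rtranclp_induct)
    case (step u v)
    then obtain c where c: "u \<in> H" "c \<in> R" "c \<in> T" "c \<in> H" "v = c \<otimes> u" "c \<notin> inversions u"
      by (auto simp: H_step_def)
    then have "up_step R (u \<otimes> y) (v \<otimes> y)"
      using coset [OF c(1,3,4)] hy by (auto simp: up_step_def m_assoc)
    then show ?case using step.IH by simp
  qed simp
  moreover have "t \<otimes> (r \<otimes> h) \<otimes> y = t \<otimes> (x \<otimes> s)"
    using rx [symmetric] hy trH by (simp add: m_assoc)
  ultimately show ?thesis using hy by simp
qed

section \<open>Lowering by one simple reflection on the right\<close>

definition lower :: "'a \<Rightarrow> 'a \<Rightarrow> 'a" where
  "lower w s = (if len (w \<otimes> s) < len w then w \<otimes> s else w)"

text \<open>If \<open>s\<close> is a right descent of both elements or of neither, lengths settle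
  the claim. If only of \<open>u\<close>, then us < u < v < vs and \<open>up_chain\<close> starts at
  us; if only of \<open>v\<close>, it starts at \<open>u\<close>, unless vs = u.\<close>

lemma lower_up_step:
  assumes R: "order_ideal_T G S R" and s: "s \<in> S" and "up_step R u v"
  shows "(up_step R)\<^sup>*\<^sup>* (lower u s) (lower v s)"
proof -
  obtain t where t: "t \<in> R" "u \<in> carrier G" "v = t \<otimes> u" "len u < len (t \<otimes> u)"
    using assms(3) by (auto simp: up_step_def)
  have tT: "t \<in> T" using R t by (auto simp: order_ideal_T_def)
  have us: "u \<otimes> s \<in> carrier G" "v \<in> carrier G" using t s tT by auto
  have vs: "v \<otimes> s = t \<otimes> (u \<otimes> s)" using t s tT by (simp add: m_assoc)
  note lens = len_mult_S [OF t(2) s] len_mult_S [OF us(2) s]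
  consider (none) "\<not> len (u \<otimes> s) < len u" "\<not> len (v \<otimes> s) < len v"
    | (both) "len (u \<otimes> s) < len u" "len (v \<otimes> s) < len v"
    | (left) "len (u \<otimes> s) < len u" "\<not> len (v \<otimes> s) < len v"
    | (right) "\<not> len (u \<otimes> s) < len u" "len (v \<otimes> s) < len v"
    by blast
  then show ?thesis
  proof cases
    case none
    then show ?thesis using assms(3) by (simp add: lower_def)
  next
    case both
    then have "up_step R (u \<otimes> s) (v \<otimes> s)"
      unfolding up_step_def using t us vs lens by (intro conjI bexI [of _ t]) auto
    then show ?thesis using both by (simp add: lower_def)
  next
    case left
    have uss: "u \<otimes> s \<otimes> s = u" using t s by (simp add: m_assoc)
    have "(up_step R)\<^sup>*\<^sup>* (u \<otimes> s) (t \<otimes> (u \<otimes> s \<otimes> s))"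
      by (rule up_chain [OF R t(1) us(1) s]) (use left t lens vs uss in auto)
    then show ?thesis using left uss t by (simp add: lower_def)
  next
    case right
    have "(up_step R)\<^sup>*\<^sup>* u (t \<otimes> (u \<otimes> s))"
    proof (cases "t \<otimes> (u \<otimes> s) = u")
      case False
      \<comment> \<open>The only inversion that us can have beyond those of \<open>u\<close> is u s
        u^-1; if \<open>t\<close> were that reflection, tus = u would follow.\<close>
      have "t \<notin> inversions (u \<otimes> s)"
      proof
        assume "t \<in> inversions (u \<otimes> s)"
        moreover have "t \<notin> inversions u" using not_inversions_iff [of u t] t tT by simp
        ultimately have "inv u \<otimes> t \<otimes> u = s"
          using inversions_mult [of u s t] inversions_S [OF s] t s tT by simp
        then have "u \<otimes> s = t \<otimes> u" using t tT by (auto simp: m_assoc)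
        then show False using False tT t by simp
      qed
      then have "len (u \<otimes> s) < len (t \<otimes> (u \<otimes> s))"
        using not_inversions_iff [of "u \<otimes> s" t] us tT by simp
      then show ?thesis
        by (intro up_chain [OF R t(1,2) s]) (use right t lens vs in auto)
    qed simp
    then show ?thesis using right vs by (simp add: lower_def)
  qed
qed

lemma lower_closed: "w \<in> carrier G \<Longrightarrow> s \<in> S \<Longrightarrow> lower w s \<in> carrier G"
  by (simp add: lower_def)

lemma lower_mono:
  assumes "order_ideal_T G S R" "s \<in> S" "(up_step R)\<^sup>*\<^sup>* u v"
  shows "(up_step R)\<^sup>*\<^sup>* (lower u s) (lower v s)"
  using assms(3)
  by (induction rule: rtranclp_induct) (auto intro: rtranclp_trans lower_up_step [OF assms(1,2)])

lemma foldl_lower_mono: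
  assumes "order_ideal_T G S R" "ss \<in> lists S" "(up_step R)\<^sup>*\<^sup>* u v"
  shows "(up_step R)\<^sup>*\<^sup>* (foldl lower u ss) (foldl lower v ss)"
  using assms(2,3)
  by (induction arbitrary: u v rule: lists.induct) (auto intro: lower_mono [OF assms(1)])

section \<open>Minimal representatives of cosets of a standard parabolic subgroup\<close>

context
  fixes J assumes J: "J \<subseteq> S"
begin

lemma J_involutions: "involutions J"
  using J S_subset_T by (intro involutions_subset_T) auto

lemma J_subgroup: "subgroup (generate G J) G"
  using J by (intro generate_is_subgroup) auto

lemma J_generate_closed: "y \<in> generate G J \<Longrightarrow> y \<in> carrier G"
  using J_subgroup subgroup.subset by blast

lemma foldl_lower_coset:
  assumes "w \<in> carrier G" "ss \<in> lists J"
  shows "foldl lower w ss \<in> carrier G \<and> (\<exists>y \<in> generate G J. w = foldl lower w ss \<otimes> y)"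
  using assms(2,1)
proof (induction arbitrary: w rule: lists.induct)
  case Nil
  then show ?case by (auto intro!: bexI [of _ \<one>] generate.one)
next
  case (Cons s ss)
  have sS: "s \<in> S" using Cons J by auto
  then obtain y where y: "y \<in> generate G J" "lower w s = foldl lower (lower w s) ss \<otimes> y"
    "foldl lower (lower w s) ss \<in> carrier G"
    using Cons.IH [of "lower w s"] Cons.prems lower_closed by blast
  have "w = lower w s \<or> w = lower w s \<otimes> s"
    using sS Cons.prems by (auto simp: lower_def m_assoc)
  then have "\<exists>z \<in> generate G J. w = lower w s \<otimes> z"
    using Cons.hyps Cons.prems lower_closed [OF Cons.prems sS]
    by (metis generate.incl generate.one r_one)
  then obtain z where "z \<in> generate G J" "w = lower w s \<otimes> z" by blast
  then have "w = foldl lower (lower w s) ss \<otimes> (y \<otimes> z)" "y \<otimes> z \<in> generate G J"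
    using y J_generate_closed by (auto simp: m_assoc [symmetric] intro: generate.eng)
  then show ?case using y(3) by auto
qed

lemma foldl_lower_min:
  assumes "x \<in> min_coset_reps G S J" "ss \<in> lists J"
  shows "foldl lower x ss = x"
  using assms(2)
  by (induction rule: lists.induct) (use assms(1) in \<open>force simp: lower_def min_coset_reps_def\<close>)+

text \<open>Otherwise the first letter of a reduced word of \<open>h\<close> over \<open>J\<close>
  would be a left descent of the inverse of \<open>x\<close>, hence a right descent of
  \<open>x\<close> in \<open>J\<close>.\<close>

lemma min_coset_rep_inverse:
  assumes x: "x \<in> min_coset_reps G S J" and h: "h \<in> generate G J" and z: "z \<in> carrier G"
    and "inv x = h \<otimes> z" "inversions z \<inter> generate G J = {}"
  shows "h = \<one>"
proof (rule ccontr)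
  assume "h \<noteq> \<one>"
  obtain ws where ws: "ws \<in> lists J" "length ws = cox_len G J h" "wprod G ws = h"
    using cox_len_word [OF J_involutions h] .
  then obtain s us where us: "ws = s # us" using \<open>h \<noteq> \<one>\<close> by (cases ws) auto
  then have s: "s \<in> J" "s \<in> S" "s \<in> T" "s \<in> generate G J" and usJ: "us \<in> lists J"
    using ws J S_subset_T by (auto intro: generate.incl)
  have "s \<otimes> h = wprod G us"
    using s us ws(3) involutions_wprod_closed [OF J_involutions usJ] by auto
  then have "cox_len G J (s \<otimes> h) < cox_len G J h"
    using cox_len_wprod_le [OF usJ] us ws(2) by simp
  moreover have "s \<in> inversions h \<longleftrightarrow> cox_len G J (s \<otimes> h) < cox_len G J h"
  proof (rule exchange)
    show "inversions a \<inter> generate G J = {a}" if "a \<in> J" for a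
      using that J inversions_S generate.incl [of a J G] by auto
  qed (use J S_subset_T s h in auto)
  ultimately have "s \<in> inversions (h \<otimes> z)"
    using inversions_coset [OF J_subgroup z assms(5) h] s by simp
  moreover have xc: "x \<in> carrier G" using x by (simp add: min_coset_reps_def)
  ultimately have "len (s \<otimes> inv x) < len (inv x)"
    unfolding assms(4) [symmetric] using inversions_iff [of "inv x" s] s by simp
  moreover have "s \<otimes> inv x = inv (x \<otimes> s)" using s xc by (simp add: inv_mult_group)
  ultimately have "len (x \<otimes> s) < len x" using len_inv xc s by simp
  then show False using x s by (auto simp: min_coset_reps_def)
qed

text \<open>By \<open>min_coset_rep_inverse\<close> the inverse of \<open>x'\<close> has no
  inversions in the parabolic subgroup. The inverse of \<open>x\<close> is then y^-1 times that
  element, and the same lemma for \<open>x\<close> gives y = 1.\<close>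

lemma min_coset_reps_unique:
  assumes x: "x \<in> min_coset_reps G S J" and x': "x' \<in> min_coset_reps G S J"
    and y: "y \<in> generate G J" and eq: "x = x' \<otimes> y"
  shows "x = x'"
proof -
  have c: "x \<in> carrier G" "x' \<in> carrier G" "y \<in> carrier G"
    using x x' y J_generate_closed by (auto simp: min_coset_reps_def)
  have sub: "generate G (canonical_gens G S (generate G J)) \<subseteq> generate G J"
    using canonical_gens_subset [of "generate G J"] J_subgroup
    by (intro generate_subgroup_incl) auto
  obtain h z where hz: "h \<in> generate G J" "z \<in> carrier G" "inv x' = h \<otimes> z"
      "inversions z \<inter> generate G J = {}"
    using min_coset_rep [OF J_subgroup, of "inv x'"] c sub by blast
  then have "h = \<one>" using min_coset_rep_inverse [OF x'] by blast
  then have "inv x = inv y \<otimes> z" using eq c hz by (simp add: inv_mult_group)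
  moreover have "inv y \<in> generate G J" using y J_subgroup by (simp add: subgroup.m_inv_closed)
  ultimately have "inv y = \<one>" using min_coset_rep_inverse [OF x] hz by blast
  then have "y = \<one>" using c inv_inv by fastforce
  then show ?thesis using eq c by simp
qed

lemma proj_J_eq:
  assumes "x \<in> min_coset_reps G S J" "y \<in> generate G J" "w = x \<otimes> y" "len w = len x + len y"
  shows "proj_J G S J w = x"
  unfolding proj_J_def
proof (rule the_equality)
  fix x' assume *: "x' \<in> min_coset_reps G S J \<and>
    (\<exists>y\<in>generate G J. w = x' \<otimes> y \<and> len w = len x' + len y)"
  then obtain y' where y': "y' \<in> generate G J" "w = x' \<otimes> y'" by blast
  have c: "x \<in> carrier G" "x' \<in> carrier G" "y \<in> carrier G" "y' \<in> carrier G"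
    using assms * y' J_generate_closed by (auto simp: min_coset_reps_def)
  have "x' = x' \<otimes> y' \<otimes> inv y'" using c by (simp add: m_assoc)
  also have "\<dots> = x \<otimes> (y \<otimes> inv y')" using assms(3) y' c by (simp add: m_assoc)
  finally have "x' = x \<otimes> (y \<otimes> inv y')" .
  moreover have "y \<otimes> inv y' \<in> generate G J"
    using assms y' J_subgroup by (simp add: subgroup.m_closed subgroup.m_inv_closed)
  ultimately show "x' = x" using min_coset_reps_unique * assms by blast
qed (use assms in blast)

text \<open>Presents \<open>P\<^sup>J\<close> as a composition of maps \<open>lower\<close>; the
  sequence of simple reflections depends on \<open>w\<close>.\<close>

lemma ex_lowering:
  assumes "w \<in> carrier G"
  shows "\<exists>ss \<in> lists J. foldl lower w ss \<in> min_coset_reps G S J \<and>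
    (\<exists>y \<in> generate G J. w = foldl lower w ss \<otimes> y \<and> len w = len (foldl lower w ss) + len y)"
  using assms
proof (induction "len w" arbitrary: w rule: less_induct)
  case less
  show ?case
  proof (cases "w \<in> min_coset_reps G S J")
    case True
    then show ?thesis using less.prems
      by (intro bexI [of _ "[]"]) (auto intro!: bexI [of _ \<one>] generate.one)
  next
    case False
    then obtain s where s: "s \<in> J" "\<not> len w < len (w \<otimes> s)"
      using less.prems by (auto simp: min_coset_reps_def)
    have sS: "s \<in> S" using s J by auto
    have ws: "w \<otimes> s \<in> carrier G" "len w = len (w \<otimes> s) + 1"
      using len_mult_S [OF less.prems sS] s less.prems sS by auto
    then have lower: "lower w s = w \<otimes> s" by (simp add: lower_def)
    obtain ss y where ss: "ss \<in> lists J" "foldl lower (w \<otimes> s) ss \<in> min_coset_reps G S J"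
      and y: "y \<in> generate G J" "w \<otimes> s = foldl lower (w \<otimes> s) ss \<otimes> y"
        "len (w \<otimes> s) = len (foldl lower (w \<otimes> s) ss) + len y"
      using less.hyps [OF _ ws(1)] ws(2) by auto
    define x where "x = foldl lower (w \<otimes> s) ss"
    have c: "x \<in> carrier G" "y \<in> carrier G"
      using ss y J_generate_closed by (auto simp: x_def min_coset_reps_def)
    have "w = w \<otimes> s \<otimes> s" using less.prems sS by (simp add: m_assoc)
    also have "\<dots> = x \<otimes> (y \<otimes> s)" using y(2) c sS by (simp add: x_def [symmetric] m_assoc)
    finally have w: "w = x \<otimes> (y \<otimes> s)" .
    have ysJ: "y \<otimes> s \<in> generate G J" using y s by (auto intro: generate.intros)
    \<comment> \<open>Lengths stay additive: w is one longer than ws and ys is at most one longer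
      than y, which together with subadditivity forces equality.\<close>
    have "len w \<le> len x + len (y \<otimes> s)"
      using cox_len_mult_le [OF S_involutions, of x "y \<otimes> s"] w c sS by (simp add: S_generate)
    moreover have "len (y \<otimes> s) \<le> len y + 1" using len_mult_S [OF c(2) sS] by auto
    ultimately have len_w: "len w = len x + len (y \<otimes> s)" using ws(2) y(3) by (simp add: x_def)
    have fold: "foldl lower w (s # ss) = x" by (simp add: lower x_def)
    show ?thesis
    proof (rule bexI)
      show "foldl lower w (s # ss) \<in> min_coset_reps G S J \<and> (\<exists>y \<in> generate G J.
          w = foldl lower w (s # ss) \<otimes> y \<and> len w = len (foldl lower w (s # ss)) + len y)"
        unfolding fold using ss(2) [folded x_def] w len_w ysJ by blast
      show "s # ss \<in> lists J" using s ss by simp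
    qed
  qed
qed

lemma proj_J_lowering:
  assumes "w \<in> carrier G"
  obtains ss where "ss \<in> lists J" "proj_J G S J w = foldl lower w ss"
    "proj_J G S J w \<in> min_coset_reps G S J"
  using ex_lowering [OF assms] proj_J_eq by metis

text \<open>The lowering sequences of \<open>u\<close> and \<open>v\<close> may differ. Applying
  that of \<open>v\<close> to both sides gives u' below the projection of \<open>v\<close>; a
  sequence for u' then fixes that projection, being minimal already. As u' stays in the coset of
  \<open>u\<close>, it has the same projection.\<close>

lemma proj_J_mono:
  assumes R: "order_ideal_T G S R" and uv: "u \<in> carrier G" "v \<in> carrier G" and "le_LX G S R u v"
  shows "le_LX G S R (proj_J G S J u) (proj_J G S J v)"
proof -
  have RT: "R \<subseteq> T" using R by (simp add: order_ideal_T_def)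
  have JS: "ss \<in> lists S" if "ss \<in> lists J" for ss using that J by auto
  let ?P = "proj_J G S J"
  obtain ss where ss: "ss \<in> lists J" "?P v = foldl lower v ss" "?P v \<in> min_coset_reps G S J"
    using proj_J_lowering [OF uv(2)] .
  define u' where "u' = foldl lower u ss"
  obtain y where y: "u' \<in> carrier G" "y \<in> generate G J" "u = u' \<otimes> y"
    using foldl_lower_coset [OF uv(1) ss(1)] unfolding u'_def by blast
  have "(up_step R)\<^sup>*\<^sup>* u' (?P v)"
    using foldl_lower_mono [OF R JS [OF ss(1)]] le_LX_iff [OF RT uv(1)] assms(4) ss
    by (simp add: u'_def)
  moreover obtain ss' where ss': "ss' \<in> lists J" "?P u' = foldl lower u' ss'"
      "?P u' \<in> min_coset_reps G S J"
    using proj_J_lowering [OF y(1)] .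
  ultimately have up: "(up_step R)\<^sup>*\<^sup>* (?P u') (?P v)"
    using foldl_lower_mono [OF R JS [OF ss'(1)], of u' "?P v"] foldl_lower_min [OF ss(3) ss'(1)]
    by simp
  obtain z where z: "?P u' \<in> carrier G" "z \<in> generate G J" "u' = ?P u' \<otimes> z"
    using foldl_lower_coset [OF y(1) ss'(1)] unfolding ss'(2) [symmetric] by blast
  obtain ss'' where ss'': "ss'' \<in> lists J" "?P u = foldl lower u ss''"
      "?P u \<in> min_coset_reps G S J"
    using proj_J_lowering [OF uv(1)] .
  obtain z' where z': "?P u \<in> carrier G" "z' \<in> generate G J" "u = ?P u \<otimes> z'"
    using foldl_lower_coset [OF uv(1) ss''(1)] unfolding ss''(2) [symmetric] by blast
  have c: "y \<in> carrier G" "z \<in> carrier G" "z' \<in> carrier G"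
    using y z z' J_generate_closed by auto
  have "?P u = ?P u \<otimes> z' \<otimes> inv z'" using c z'(1) by (simp add: m_assoc)
  also have "\<dots> = ?P u' \<otimes> z \<otimes> y \<otimes> inv z'" using y(3) z(3) z'(3) by metis
  also have "\<dots> = ?P u' \<otimes> (z \<otimes> y \<otimes> inv z')" using c z(1) by (simp add: m_assoc)
  finally have "?P u = ?P u' \<otimes> (z \<otimes> y \<otimes> inv z')" .
  moreover have "z \<otimes> y \<otimes> inv z' \<in> generate G J"
    using y z z' J_subgroup by (simp add: subgroup.m_closed subgroup.m_inv_closed)
  ultimately have "?P u = ?P u'" using min_coset_reps_unique ss' ss'' by blast
  then show ?thesis using up le_LX_iff [OF RT z(1)] by simp
qed

end

text \<open>Arrows of the Bruhat graph increase length. Hence reflections of bounded length form an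
  order ideal, which yields the case of the k-intermediate orders.\<close>

lemma refl_sq_len:
  assumes "refl_sq G S t t'" shows "t \<in> T \<and> len t \<le> len t'"
proof -
  have step: "t \<in> T \<and> len t \<le> len t'" if sq: "refl_sq' G S t t'" for t t'
  proof -
    have "len t \<le> len t'" if "(bruhat_arrow_on G S W')\<^sup>*\<^sup>* t t'" for W'
      using that
    proof (induction rule: rtranclp_induct)
      case (step y z)
      then show ?case
        using bruhat_lt_len [of y z] by (auto simp: bruhat_arrow_on_def bruhat_arrow_def)
    qed simp
    then show ?thesis using sq by (auto simp: refl_sq'_def)
  qed
  show ?thesis
    using assms unfolding refl_sq_def
    by (induction rule: tranclp_induct) (use step in \<open>auto intro: le_trans\<close>)
qed

lemma order_ideal_T_k: "order_ideal_T G S (refl_T_k G S k)"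
  unfolding order_ideal_T_def refl_T_k_def by (auto dest!: refl_sq_len)

end

theorem theorem3p8:
  fixes G :: "('a, 'b) monoid_scheme" and S J :: "'a set"
  assumes "coxeter_system G S" and "J \<subseteq> S"
  shows "(\<forall>R. order_ideal_T G S R \<longrightarrow>
            (\<forall>u \<in> carrier G. \<forall>v \<in> carrier G. le_LX G S R u v \<longrightarrow>
               le_LX G S R (proj_J G S J u) (proj_J G S J v)))
       \<and> (\<forall>k::nat. \<forall>u \<in> carrier G. \<forall>v \<in> carrier G. le_Lk G S k u v \<longrightarrow>
               le_Lk G S k (proj_J G S J u) (proj_J G S J v))"
proof -
  interpret coxeter G S
    using assms(1) by (auto simp: coxeter_def coxeter_axioms_def coxeter_system_def)
  show ?thesis
    using proj_J_mono [OF assms(2)] order_ideal_T_k unfolding le_Lk_def by blast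
qed

end
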